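(* For every fixed positive integer $c$, there is a (polynomial-time) $2^{c-1}P(c)$-approximation algorithm for $c$-Load Coloring, where $P(c)=\prod_{i=1}^{c}\frac{K(i)}{i}$, $K(1)=1$, and $K(i)=16i^2-6i$ for $i\ge 2$.
   Context: Graphs are finite, simple and undirected; $[c]=\{1,\dots,c\}$. For a positive integer $c$, a nonnegative integer $k$ and a graph $G=(V,E)$, write $G\in(c,k)$-LCP if there is a map $\varphi:V\to[c]$ such that for every $i\in[c]$ at least $k$ edges have both endvertices colored $i$. $c$-Load Coloring (optimization problem): given a graph $G$, determine the maximum $k$, denoted $k_{opt}$, such that $G\in(c,k)$-LCP. The approximation ratio of an algorithm that outputs a value $k$ with $G\in(c,k)$-LCP is $k_{opt}/k$; thus an $r$-approximation algorithm is a polynomial-time algorithm (for fixed $c$) that, on every input $G$, outputs $k$ with $G\in (c,k)$-LCP and $k_{opt}\le r\cdot k$. *)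

theory Defs
  imports Complex_Main "HOL-Computational_Algebra.Polynomial"
begin

definition simple_graph :: "'a set \<Rightarrow> 'a set set \<Rightarrow> bool" where
  "simple_graph V E \<longleftrightarrow> finite V \<and> (\<forall>e\<in>E. e \<subseteq> V \<and> card e = 2)"

definition LCP :: "nat \<Rightarrow> nat \<Rightarrow> 'a set \<Rightarrow> 'a set set \<Rightarrow> bool" where
  "LCP c k V E \<longleftrightarrow>
    (\<exists>\<phi>. \<phi> ` V \<subseteq> {1..c} \<and> (\<forall>i\<in>{1..c}. k \<le> card {e \<in> E. \<forall>v\<in>e. \<phi> v = i}))"

(* For c > 0 and a simple graph the set is nonempty (k = 0) and bounded by card E,
   so Max is the true maximum. *)
definition k_opt :: "nat \<Rightarrow> 'a set \<Rightarrow> 'a set set \<Rightarrow> nat" where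
  "k_opt c V E = Max {k. LCP c k V E}"

definition K :: "nat \<Rightarrow> real" where
  "K i = (if i = 1 then 1 else 16 * (real i)\<^sup>2 - 6 * real i)"

definition P :: "nat \<Rightarrow> real" where
  "P c = (\<Prod>i=1..c. K i / real i)"

(* Algorithms are programs of a random access machine with a register file and an
   addressable memory, both holding natural numbers, under the uniform cost measure.
   As addition and (truncated) subtraction are the only arithmetic operations, t steps
   lengthen the numbers by at most t bits, hence polynomial time on this machine
   coincides with polynomial time on Turing machines. Control flow is structured
   instead of jump-based. *)
datatype program =
    Const nat nat
  | Add nat nat nat
  | Sub nat nat nat
  | Load nat nat
  | Store nat nat
  | Seq program program
  | If_Nonzero nat program program
  | While_Nonzero nat program

type_synonym state = "(nat \<Rightarrow> nat) \<times> (nat \<Rightarrow> nat)"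

(* exec p s t s': started in state s (registers, memory), p halts after t steps in s'.
   Load and Store take the memory address from register a. *)
inductive exec :: "program \<Rightarrow> state \<Rightarrow> nat \<Rightarrow> state \<Rightarrow> bool" where
  Const: "exec (Const d n) (R, M) 1 (R(d := n), M)"
| Add: "exec (Add d x y) (R, M) 1 (R(d := R x + R y), M)"
| Sub: "exec (Sub d x y) (R, M) 1 (R(d := R x - R y), M)"
| Load: "exec (Load d a) (R, M) 1 (R(d := M (R a)), M)"
| Store: "exec (Store a x) (R, M) 1 (R, M(R a := R x))"
| Seq: "exec p s t s' \<Longrightarrow> exec q s' u s'' \<Longrightarrow> exec (Seq p q) s (t + u) s''"
| If_True: "R x \<noteq> 0 \<Longrightarrow> exec p (R, M) t s' \<Longrightarrow> exec (If_Nonzero x p q) (R, M) (t + 1) s'"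
| If_False: "R x = 0 \<Longrightarrow> exec q (R, M) t s' \<Longrightarrow> exec (If_Nonzero x p q) (R, M) (t + 1) s'"
| While_False: "R x = 0 \<Longrightarrow> exec (While_Nonzero x p) (R, M) 1 (R, M)"
| While_True: "R x \<noteq> 0 \<Longrightarrow> exec p (R, M) t s' \<Longrightarrow> exec (While_Nonzero x p) s' u s'' \<Longrightarrow>
    exec (While_Nonzero x p) (R, M) (t + u + 1) s''"

inductive_cases Const_E: "exec (Const d n) s t s'"
inductive_cases Add_E: "exec (Add d x y) s t s'"
inductive_cases Sub_E: "exec (Sub d x y) s t s'"
inductive_cases Load_E: "exec (Load d a) s t s'"
inductive_cases Store_E: "exec (Store a x) s t s'"
inductive_cases Seq_E: "exec (Seq p q) s t s'"
inductive_cases If_E: "exec (If_Nonzero x p q) s t s'"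
inductive_cases While_E: "exec (While_Nonzero x p) s t s'"

lemma exec_deterministic:
  "exec p s t s1 \<Longrightarrow> exec p s t2 s2 \<Longrightarrow> t2 = t \<and> s2 = s1"
proof (induction arbitrary: t2 s2 rule: exec.induct)
  case (Const d n R M)
  then show ?case by (rule Const_E) simp
next
  case (Add d x y R M)
  then show ?case by (rule Add_E) simp
next
  case (Sub d x y R M)
  then show ?case by (rule Sub_E) simp
next
  case (Load d a R M)
  then show ?case by (rule Load_E) simp
next
  case (Store a x R M)
  then show ?case by (rule Store_E) simp
next
  case (Seq p s t s' q u s'')
  from Seq.prems obtain a b s1' where "t2 = a + b" "exec p s a s1'" "exec q s1' b s2"
    by (rule Seq_E)
  with Seq.IH(1)[of a s1'] Seq.IH(2)[of b s2] show ?case by simp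
next
  case (If_True R x p M t s' q)
  from If_True.prems If_True.hyps obtain a where "t2 = a + 1" "exec p (R, M) a s2"
    by (auto elim: If_E)
  with If_True.IH[of a s2] show ?case by simp
next
  case (If_False R x q M t s' p)
  from If_False.prems If_False.hyps obtain a where "t2 = a + 1" "exec q (R, M) a s2"
    by (auto elim: If_E)
  with If_False.IH[of a s2] show ?case by simp
next
  case (While_False R x p M)
  from While_False.prems show ?case by (rule While_E) (use While_False.hyps in simp_all)
next
  case (While_True R x p M t s' u s'')
  from While_True.prems While_True.hyps(1) obtain a b s1'
    where "t2 = a + b + 1" "exec p (R, M) a s1'" "exec (While_Nonzero x p) s1' b s2"
    by (auto elim: While_E)
  with While_True.IH(1)[of a s1'] While_True.IH(2)[of b s2] show ?case by simp
qed

definition initial_state :: "nat list \<Rightarrow> state" where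
  "initial_state xs = ((\<lambda>_. 0), (\<lambda>a. if a < length xs then xs ! a else 0))"

definition halts_with :: "program \<Rightarrow> nat list \<Rightarrow> nat \<Rightarrow> nat \<Rightarrow> bool" where
  "halts_with p xs t y \<longleftrightarrow> (\<exists>R M. exec p (initial_state xs) t (R, M) \<and> R 0 = y)"

(* The number of vertices followed by the rows of the adjacency matrix. *)
definition encode_graph :: "nat \<Rightarrow> nat set set \<Rightarrow> nat list" where
  "encode_graph n E =
    n # concat (map (\<lambda>i. map (\<lambda>j. if {i, j} \<in> E then 1 else 0) [0..<n]) [0..<n])"

(* Apart from the first entry n, inputs consist of n^2 bits, so their length measures
   the input size up to a logarithmic term. *)
definition LC_approximation_algorithm :: "nat \<Rightarrow> real \<Rightarrow> program \<Rightarrow> bool" where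
  "LC_approximation_algorithm c r p \<longleftrightarrow>
    (\<exists>b :: nat poly. \<forall>n E. simple_graph {..<n} E \<longrightarrow>
      (\<exists>t k. halts_with p (encode_graph n E) t k \<and>
             t \<le> poly b (length (encode_graph n E)) \<and>
             LCP c k {..<n} E \<and>
             real (k_opt c {..<n} E) \<le> r * real k))"

end

theory Submission
  imports Defs
begin

text \<open>
  Every colour class avoiding a set \<open>S\<close> of fewer than \<open>c\<close> vertices has all its edges in \<open>G - S\<close>, so
  \<open>k_opt\<close> is at most the number \<open>m\<close> of edges that survive the worst deletion of \<open>c - 1\<close> vertices.
  Conversely \<open>m \<ge> threshold c * k\<close> suffices for \<open>k\<close> edges in each of \<open>c\<close> disjoint vertex sets. If some
  vertex has degree at least \<open>(2c - 1)k\<close>, delete it and use induction: the other \<open>c - 1\<close> classes need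
  at most \<open>2(c - 1)k\<close> vertices, so \<open>k\<close> edges of the star remain. If all degrees are small, the graph is
  repeatedly split into two parts that both keep about a sixth of the edges. The only additional
  information needed, to tell \<open>k_opt = 0\<close> from \<open>k_opt = 1\<close>, is whether there is a matching of size \<open>c\<close>.
  Both quantities are found by running through all \<open>2c\<close>-tuples of vertices.
\<close>

section \<open>Packing edges into disjoint vertex sets\<close>

definition induced :: "'a set set \<Rightarrow> 'a set \<Rightarrow> 'a set set" where
  "induced E W = {e \<in> E. e \<subseteq> W}"

text \<open>Classes are peeled off one at a time, as the inductions below produce them; vertices may
  be left over.\<close>

fun packs :: "nat \<Rightarrow> nat \<Rightarrow> 'a set set \<Rightarrow> 'a set \<Rightarrow> bool" where
  "packs 0 k E V = True"
| "packs (Suc c) k E V = (\<exists>W\<subseteq>V. k \<le> card (induced E W) \<and> packs c k E (V - W))"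

text \<open>Counting ordered pairs makes this additive in both arguments;
  \<open>arcs E {v} V\<close> is the degree of \<open>v\<close>, \<open>arcs E V V\<close> the
  degree sum.\<close>

definition arcs :: "'a set set \<Rightarrow> 'a set \<Rightarrow> 'a set \<Rightarrow> nat" where
  "arcs E X Y = (\<Sum>x\<in>X. \<Sum>y\<in>Y. of_bool ({x, y} \<in> E))"

lemma finite_induced: "finite E \<Longrightarrow> finite (induced E W)"
  by (simp add: induced_def)

lemma induced_mono: "W \<subseteq> W' \<Longrightarrow> induced E W \<subseteq> induced E W'"
  by (auto simp: induced_def)

lemma card_induced_mono:
  "finite E \<Longrightarrow> W \<subseteq> W' \<Longrightarrow> card (induced E W) \<le> card (induced E W')"
  by (simp add: card_mono finite_induced induced_mono)

lemma simple_graph_finite_edges: "simple_graph V E \<Longrightarrow> finite E"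
  unfolding simple_graph_def by (meson PowI finite_Pow_iff finite_subset subsetI)

section \<open>Counting arcs\<close>

lemma arcs_commute: "arcs E X Y = arcs E Y X"
  unfolding arcs_def by (subst sum.swap) (simp add: insert_commute)

lemma arcs_Un_left:
  "\<lbrakk>finite X; finite X'; X \<inter> X' = {}\<rbrakk> \<Longrightarrow> arcs E (X \<union> X') Y = arcs E X Y + arcs E X' Y"
  unfolding arcs_def by (rule sum.union_disjoint)

lemma arcs_Un_right:
  "\<lbrakk>finite Y; finite Y'; Y \<inter> Y' = {}\<rbrakk> \<Longrightarrow> arcs E X (Y \<union> Y') = arcs E X Y + arcs E X Y'"
  by (simp add: arcs_commute[of E X] arcs_Un_left)

lemma arcs_Un_self:
  assumes "finite X" "finite Y" "X \<inter> Y = {}"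
  shows "arcs E (X \<union> Y) (X \<union> Y) = arcs E X X + 2 * arcs E X Y + arcs E Y Y"
  using assms by (simp add: arcs_Un_left arcs_Un_right arcs_commute[of E Y X])

lemma arcs_mono:
  "finite X' \<Longrightarrow> finite Y' \<Longrightarrow> X \<subseteq> X' \<Longrightarrow> Y \<subseteq> Y' \<Longrightarrow> arcs E X Y \<le> arcs E X' Y'"
  unfolding arcs_def
  by (rule order.trans[OF sum_mono[OF sum_mono2] sum_mono2]) (auto simp del: sum_of_bool_eq)

lemma arcs_eq_sum: "arcs E X Y = (\<Sum>x\<in>X. arcs E {x} Y)"
  by (simp add: arcs_def)

lemma arcs_card: "finite X \<Longrightarrow> finite Y \<Longrightarrow> arcs E X Y = card {(x, y) \<in> X \<times> Y. {x, y} \<in> E}"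
  unfolding arcs_def sum.cartesian_product
  by (simp add: case_prod_unfold of_bool_def sum.If_cases Int_def conj_assoc mem_Times_iff)

lemma arcs_singleton: "finite Y \<Longrightarrow> arcs E {x} Y = card {y \<in> Y. {x, y} \<in> E}"
  by (simp add: arcs_def of_bool_def sum.If_cases Int_def)

text \<open>An edge has two distinct ends, hence exactly two orderings, and different edges yield
  disjoint sets of pairs.\<close>

lemma arcs_self:
  assumes "finite W" "\<forall>e\<in>E. card e = 2"
  shows "arcs E W W = 2 * card (induced E W)"
proof -
  have fin: "finite (induced E W)"
    using assms(1) by (rule finite_subset[rotated, OF finite_Pow_iff[THEN iffD2]]) (auto simp: induced_def)
  have eq: "{(x, y) \<in> W \<times> W. {x, y} \<in> E} = (\<Union>e\<in>induced E W. {(x, y). {x, y} = e})"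
    by (auto simp: induced_def)
  have two: "finite {(x, y). {x, y} = e} \<and> card {(x, y). {x, y} = e} = 2" if "e \<in> induced E W" for e
  proof -
    from that assms(2) have "card e = 2" by (auto simp: induced_def)
    then obtain a b where ab: "e = {a, b}" "a \<noteq> b" by (auto simp: card_2_iff)
    then have "{(x, y). {x, y} = e} = {(a, b), (b, a)}" by (auto simp: doubleton_eq_iff)
    with ab show ?thesis by simp
  qed
  have "card (\<Union>e\<in>induced E W. {(x, y). {x, y} = e}) = (\<Sum>e\<in>induced E W. card {(x, y). {x, y} = e})"
    using fin two by (intro card_UN_disjoint) auto
  also have "\<dots> = 2 * card (induced E W)" using two by simp
  finally show ?thesis unfolding arcs_card[OF assms(1) assms(1)] eq .
qed

section \<open>Balanced splitting\<close>

text \<open>When elements are added one by one, each raises the sum by at most \<open>D\<close>, so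
  the first sum to reach \<open>b\<close> overshoots by at most \<open>D\<close>.\<close>

lemma subset_sum_between:
  fixes f :: "'a \<Rightarrow> nat"
  assumes "finite X" "\<forall>x\<in>X. f x \<le> D" "b \<le> sum f X"
  shows "\<exists>Y\<subseteq>X. b \<le> sum f Y \<and> sum f Y \<le> b + D"
  using assms
proof (induction X rule: finite_induct)
  case (insert x X)
  show ?case
  proof (cases "b \<le> sum f X")
    case True
    with insert show ?thesis by (meson insertI2 insert_subset subset_insertI subset_trans)
  next
    case False
    with insert.prems insert.hyps show ?thesis by (intro exI[of _ "insert x X"]) auto
  qed
qed auto

lemma arcs_between:
  assumes "finite X" "\<forall>x\<in>X. arcs E {x} Y \<le> D" "b \<le> arcs E X Y"
  shows "\<exists>X'\<subseteq>X. b \<le> arcs E X' Y \<and> arcs E X' Y \<le> b + D"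
  using subset_sum_between[OF assms(1,2), of b] assms(3) by (simp flip: arcs_eq_sum)

text \<open>
  Split \<open>V\<close> into \<open>X\<close> and \<open>Y\<close> with equal degree sums. If one side is too sparse, then so is the other,
  and most arcs run between \<open>X\<close> and \<open>Y\<close>. Halve \<open>X\<close> by its arcs to \<open>Y\<close>, and then \<open>Y\<close> by its arcs to the
  first half of \<open>X\<close>; one of the two ways of matching the halves of \<open>X\<close> with those of \<open>Y\<close> works.
\<close>

lemma split_two:
  assumes fin: "finite V"
    and deg: "\<forall>v\<in>V. arcs E {v} V \<le> D"
    and many: "6 * q + 10 * D + 6 \<le> arcs E V V"
  shows "\<exists>W\<subseteq>V. q \<le> arcs E W W \<and> q \<le> arcs E (V - W) (V - W)"
proof -
  have deg': "arcs E {v} Z \<le> D" if "v \<in> V" "Z \<subseteq> V" for v Z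
  proof -
    have "arcs E {v} Z \<le> arcs E {v} V" using that fin by (intro arcs_mono) auto
    also have "\<dots> \<le> D" using that deg by blast
    finally show ?thesis .
  qed
  obtain X where X: "X \<subseteq> V" "arcs E V V div 2 \<le> arcs E X V" "arcs E X V \<le> arcs E V V div 2 + D"
    using arcs_between[OF fin deg div_le_dividend] by blast
  define Y where "Y = V - X"
  have Y: "X \<inter> Y = {}" "V = X \<union> Y" "finite X" "finite Y"
    using X(1) fin by (auto simp: Y_def intro: finite_subset)
  have VV: "arcs E V V = arcs E X X + 2 * arcs E X Y + arcs E Y Y"
    unfolding Y(2) using Y by (simp add: arcs_Un_self)
  have XV: "arcs E X V = arcs E X X + arcs E X Y"
    unfolding Y(2) using Y by (simp add: arcs_Un_right)
  show ?thesis
  proof (cases "q \<le> arcs E X X \<and> q \<le> arcs E Y Y")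
    case True
    with X(1) show ?thesis by (auto simp: Y_def)
  next
    case False
    define M where "M = arcs E X Y"
    \<comment> \<open>Each side carries half of the degree sum, \<open>Y\<close> possibly up to
      \<open>D\<close> less. On a sparse side fewer than \<open>q\<close> of these arcs stay inside;
      the others cross.\<close>
    have M: "4 * q + 8 * D + 6 \<le> 2 * M"
    proof -
      have "arcs E X X < q \<or> arcs E Y Y < q" using False by auto
      then show ?thesis using VV XV X(2,3) many unfolding M_def by (elim disjE) linarith+
    qed
    have deg1: "\<forall>x\<in>X. arcs E {x} Y \<le> D" using deg' Y(2) by blast
    obtain X1 where X1: "X1 \<subseteq> X" "M div 2 \<le> arcs E X1 Y" "arcs E X1 Y \<le> M div 2 + D"
      using arcs_between[of X E Y D "M div 2"] Y(3) deg1 unfolding M_def by (meson div_le_dividend)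
    define X2 where "X2 = X - X1"
    have X2: "X1 \<inter> X2 = {}" "X = X1 \<union> X2" "finite X1" "finite X2"
      using X1(1) Y(3) by (auto simp: X2_def intro: finite_subset)
    have M12: "M = arcs E X1 Y + arcs E X2 Y"
      unfolding M_def X2(2) using X2 by (simp add: arcs_Un_left)
    define F where "F = arcs E X1 Y"
    have deg2: "\<forall>y\<in>Y. arcs E {y} X1 \<le> D" using deg' Y(2) X1(1) by blast
    obtain Y1 where Y1: "Y1 \<subseteq> Y" "F div 2 \<le> arcs E Y1 X1" "arcs E Y1 X1 \<le> F div 2 + D"
      using arcs_between[of Y E X1 D "F div 2"] Y(4) deg2
      unfolding F_def arcs_commute[of E X1] by (meson div_le_dividend)
    define Y2 where "Y2 = Y - Y1"
    have Y2: "Y1 \<inter> Y2 = {}" "Y = Y1 \<union> Y2" "finite Y1" "finite Y2"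
      using Y1(1) Y(4) by (auto simp: Y2_def intro: finite_subset)
    have F12: "F = arcs E X1 Y1 + arcs E X1 Y2"
      unfolding F_def Y2(2) using Y2 by (simp add: arcs_Un_right)
    have G12: "arcs E X2 Y = arcs E X2 Y1 + arcs E X2 Y2"
      unfolding Y2(2) using Y2 by (simp add: arcs_Un_right)
    have Y1': "F div 2 \<le> arcs E X1 Y1" "arcs E X1 Y1 \<le> F div 2 + D"
      using Y1 by (simp_all add: arcs_commute[of E X1])
    \<comment> \<open>\<open>X1\<close> has at least \<open>q / 2\<close> arcs to each half of
      \<open>Y\<close>. \<open>X2\<close> has at least \<open>q\<close> arcs to \<open>Y\<close>,
      hence \<open>q / 2\<close> to one half, and \<open>X1\<close> takes the other half.\<close>
    have "q \<le> 2 * arcs E X1 Y1" "q \<le> 2 * arcs E X1 Y2" "2 * q \<le> 2 * arcs E X2 Y"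
      using M X1(2,3) M12 F12 Y1' unfolding F_def by linarith+
    then have *: "(q \<le> 2 * arcs E X1 Y1 \<and> q \<le> 2 * arcs E X2 Y2) \<or>
        (q \<le> 2 * arcs E X1 Y2 \<and> q \<le> 2 * arcs E X2 Y1)"
      using G12 by (cases "q \<le> 2 * arcs E X2 Y2") auto
    have part: "2 * arcs E A B \<le> arcs E (A \<union> B) (A \<union> B)" if "A \<subseteq> X" "B \<subseteq> Y" for A B
    proof -
      from that Y have "finite A" "finite B" "A \<inter> B = {}" by (auto intro: finite_subset)
      then show ?thesis by (simp add: arcs_Un_self)
    qed
    have sub: "X2 \<subseteq> X" "Y2 \<subseteq> Y" by (auto simp: X2_def Y2_def)
    have c1: "V - (X1 \<union> Y1) = X2 \<union> Y2" and c2: "V - (X1 \<union> Y2) = X2 \<union> Y1"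
      using Y(1,2) X2(1,2) Y2(1,2) by blast+
    have sub': "X1 \<union> Y1 \<subseteq> V" "X1 \<union> Y2 \<subseteq> V"
      using X1(1) Y1(1) sub(2) unfolding Y(2) by blast+
    from * show ?thesis
    proof
      assume "q \<le> 2 * arcs E X1 Y1 \<and> q \<le> 2 * arcs E X2 Y2"
      then show ?thesis
        using part[OF X1(1) Y1(1)] part[OF sub]
        by (intro exI[of _ "X1 \<union> Y1"] conjI sub', linarith, unfold c1, linarith)
    next
      assume "q \<le> 2 * arcs E X1 Y2 \<and> q \<le> 2 * arcs E X2 Y1"
      then show ?thesis
        using part[OF X1(1) sub(2)] part[OF sub(1) Y1(1)]
        by (intro exI[of _ "X1 \<union> Y2"] conjI sub', linarith, unfold c2, linarith)
    qed
  qed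
qed

section \<open>Many edges give a packing\<close>

text \<open>\<open>split_two\<close> turns \<open>6 * x + 5 * (D + 1)\<close> edges into two parts
  with at least \<open>x\<close> edges each. Adding \<open>D + 1\<close> to the edge counts makes
  this a plain factor 6. One part becomes a class, the other is split further.\<close>

lemma packs_bounded_degree:
  assumes "\<forall>e\<in>E. card e = 2"
  shows "finite V \<Longrightarrow> \<forall>v\<in>V. arcs E {v} V \<le> D \<Longrightarrow>
    6 ^ c * (k + D + 1) \<le> card (induced E V) + D + 1 \<Longrightarrow> packs (Suc c) k E V"
proof (induction c arbitrary: V)
  case 0
  then show ?case by auto
next
  case (Suc c)
  define x where "x = 6 ^ c * (k + D + 1) - (D + 1)"
  have ge: "k + D + 1 \<le> 6 ^ c * (k + D + 1)"
    using mult_le_mono1[of 1 "6 ^ c" "k + D + 1"] by simp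
  then have x: "k \<le> x" "6 ^ c * (k + D + 1) = x + D + 1" by (simp_all add: x_def)
  have "6 * (2 * x) + 10 * D + 6 \<le> arcs E V V"
    using Suc.prems(1,3) x(2) by (simp add: arcs_self assms)
  from split_two[OF Suc.prems(1,2) this] obtain W
    where W: "W \<subseteq> V" "2 * x \<le> arcs E W W" "2 * x \<le> arcs E (V - W) (V - W)" by blast
  have "finite W" using W(1) Suc.prems(1) by (rule finite_subset)
  then have "k \<le> card (induced E W)" using W(2) x(1) by (simp add: arcs_self assms)
  moreover have "packs (Suc c) k E (V - W)"
  proof (rule Suc.IH)
    show "\<forall>v\<in>V - W. arcs E {v} (V - W) \<le> D"
      using Suc.prems(1,2) arcs_mono[of _ V _ "V - W" E] by (meson DiffD1 Diff_subset finite.emptyI finite.insertI order_refl le_trans)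
  qed (use Suc.prems(1) W(3) x(2) in \<open>auto simp: arcs_self assms\<close>)
  ultimately show ?case using W(1) by (metis packs.simps(2))
qed

text \<open>A class can be shrunk to the ends of \<open>k\<close> of its edges, which are at most
  \<open>2 * k\<close> vertices.\<close>

lemma packs_few_vertices:
  assumes "finite E" "\<forall>e\<in>E. card e = 2"
  shows "packs c k E V \<Longrightarrow> \<exists>U\<subseteq>V. finite U \<and> card U \<le> 2 * k * c \<and> packs c k E U"
proof (induction c arbitrary: V)
  case 0
  show ?case by (intro exI[of _ "{}"]) auto
next
  case (Suc c)
  then obtain W where W: "W \<subseteq> V" "k \<le> card (induced E W)" "packs c k E (V - W)" by auto
  from Suc.IH[OF W(3)] obtain U where U: "U \<subseteq> V - W" "finite U" "card U \<le> 2 * k * c" "packs c k E U"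
    by blast
  obtain F where F: "F \<subseteq> induced E W" "card F = k" "finite F"
    using W(2) by (meson obtain_subset_with_card_n)
  have two: "card e = 2" "finite e" "e \<subseteq> W" if "e \<in> F" for e
    using that F(1) assms(2) by (fastforce simp: induced_def intro: card_ge_0_finite)+
  have "card (\<Union>F) \<le> (\<Sum>e\<in>F. card e)" by (rule card_Union_le_sum_card)
  then have cU: "card (\<Union>F) \<le> 2 * k" using two F(2) by simp
  have fU: "finite (\<Union>F)" using F(3) two by blast
  have "F \<subseteq> induced E (\<Union>F)" using F(1) by (auto simp: induced_def)
  then have "k \<le> card (induced E (\<Union>F))"
    using F(2) assms(1) by (metis card_mono finite_induced)
  moreover have "(\<Union>F \<union> U) - \<Union>F = U" using U(1) two by blast
  ultimately have "packs (Suc c) k E (\<Union>F \<union> U)"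
    using U(4) unfolding packs.simps by (metis Un_upper1)
  moreover have "card (\<Union>F \<union> U) \<le> 2 * k * Suc c"
    using card_Un_le[of "\<Union>F" U] cU U(3) by simp
  moreover have "\<Union>F \<union> U \<subseteq> V" using two U(1) W(1) by blast
  ultimately show ?case using fU U(2) by (metis finite_UnI)
qed

lemma star_edges:
  assumes "finite E" "finite V" "v \<in> V"
  shows "arcs E {v} V \<le> card (induced E V)"
proof -
  have "inj_on (\<lambda>y. {v, y}) {y \<in> V. {v, y} \<in> E}" by (auto simp: inj_on_def doubleton_eq_iff)
  then have "card {y \<in> V. {v, y} \<in> E} \<le> card (induced E V)"
    by (rule card_inj_on_le) (use assms in \<open>auto simp: induced_def\<close>)
  then show ?thesis using assms(2) by (simp add: arcs_singleton)
qed

text \<open>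
  \<open>threshold c * k = 6 ^ (c - 1) * (k + D + 1) - (D + 1)\<close> for the degree bound \<open>D + 1 = (2 * c - 1) * k\<close>
  in \<open>packs_bounded_degree\<close>.
\<close>

definition threshold :: "nat \<Rightarrow> nat" where
  "threshold c = 2 * c * (6 ^ (c - 1) - 1) + 1"

lemma threshold_mono: "threshold c \<le> threshold (Suc c)"
proof (cases c)
  case (Suc d)
  have "6 ^ d - 1 \<le> 6 ^ Suc d - (1::nat)" by (simp add: diff_le_mono)
  then have "2 * Suc d * (6 ^ d - 1) \<le> 2 * Suc (Suc d) * (6 ^ Suc d - (1::nat))"
    by (intro mult_le_mono) auto
  then show ?thesis by (simp only: threshold_def Suc diff_Suc_1 add_le_mono1)
qed (simp add: threshold_def)

text \<open>Robustness passes to \<open>V - {v}\<close> with one deletion less, because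
  \<open>v\<close> can be added to every deletion set.\<close>

lemma packs_if_robust:
  assumes E: "finite E" "\<forall>e\<in>E. card e = 2" and k: "0 < k"
  shows "finite V \<Longrightarrow> \<forall>S\<subseteq>V. card S < c \<longrightarrow> threshold c * k \<le> card (induced E (V - S)) \<Longrightarrow> packs c k E V"
proof (induction c arbitrary: V)
  case 0
  show ?case by simp
next
  case (Suc c)
  show ?case
  proof (cases "\<exists>v\<in>V. (2 * c + 1) * k \<le> arcs E {v} V")
    case True
    then obtain v where v: "v \<in> V" "(2 * c + 1) * k \<le> arcs E {v} V" by blast
    have "packs c k E (V - {v})"
    proof (rule Suc.IH, use Suc.prems(1) in simp, intro allI impI)
      fix S assume S: "S \<subseteq> V - {v}" "card S < c"
      have "card (insert v S) < Suc c"
        using S Suc.prems(1) by (auto simp: card_insert_if dest: finite_subset)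
      moreover have "insert v S \<subseteq> V" using S v by auto
      ultimately have "threshold (Suc c) * k \<le> card (induced E (V - insert v S))"
        using Suc.prems(2) by blast
      then show "threshold c * k \<le> card (induced E (V - {v} - S))"
        using threshold_mono[of c] mult_le_mono1[of "threshold c" "threshold (Suc c)" k]
        by (metis Diff_insert2 le_trans)
    qed
    from packs_few_vertices[OF E this] obtain U
      where U: "U \<subseteq> V - {v}" "finite U" "card U \<le> 2 * k * c" "packs c k E U" by blast
    \<comment> \<open>At most \<open>card U \<le> 2 * k * c\<close> of the
      \<open>(2 * c + 1) * k\<close> neighbors lie in \<open>U\<close>, so \<open>k\<close> edges of
      the star at \<open>v\<close> avoid \<open>U\<close>.\<close>
    have "arcs E {v} V = arcs E {v} (V - U) + arcs E {v} U"
      using arcs_Un_right[of "V - U" U E "{v}"] Suc.prems(1) U(1,2)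
      by (metis Diff_disjoint Int_commute Un_Diff_cancel2 finite_Diff sup.absorb1 Diff_subset subset_trans)
    moreover have "arcs E {v} U \<le> card U"
      using U(2) by (simp add: arcs_singleton card_mono)
    ultimately have "k \<le> arcs E {v} (V - U)" using v(2) U(3) by (simp add: algebra_simps)
    also have "\<dots> \<le> card (induced E (V - U))"
      using E(1) Suc.prems(1) v(1) U(1) by (intro star_edges) auto
    finally have "k \<le> card (induced E (V - U))" .
    moreover have "V - (V - U) = U" using U(1) by auto
    ultimately show ?thesis using U(4) unfolding packs.simps by (metis Diff_subset)
  next
    case False
    \<comment> \<open>The subtraction is exact as \<open>0 < k\<close>, so a degree below
      \<open>(2 * c + 1) * k\<close> is at most \<open>D\<close>.\<close>
    define D where "D = (2 * c + 1) * k - 1"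
    have D: "D + 1 = (2 * c + 1) * k" using k by (simp add: D_def)
    have deg: "\<forall>v\<in>V. arcs E {v} V \<le> D" using False D by (auto simp: not_le)
    have "threshold (Suc c) * k \<le> card (induced E V)"
      using Suc.prems(2)[rule_format, of "{}"] by simp
    moreover have "threshold (Suc c) * k + (D + 1) = 6 ^ c * (k + (D + 1))"
    proof -
      obtain b where b: "(6::nat) ^ c = b + 1" by (metis add.commute le_add_diff_inverse one_le_numeral one_le_power)
      show ?thesis unfolding D threshold_def by (simp add: b algebra_simps)
    qed
    ultimately show ?thesis using Suc.prems(1) deg packs_bounded_degree[OF E(2), of V D c k] by simp
  qed
qed

section \<open>Load colorings, packings and matchings\<close>

text \<open>Each class gets a color of its own, and left-over vertices get color 1, which cannot
  lose edges. The induction counts only edges inside \<open>U\<close>, so that recoloring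
  \<open>W\<close> does not disturb the colors found in \<open>U - W\<close>.\<close>

lemma LCP_if_packs:
  assumes V: "simple_graph V E"
  shows "packs (Suc c) k E V \<Longrightarrow> LCP (Suc c) k V E"
proof -
  have fE: "finite E" using V by (rule simple_graph_finite_edges)
  have "\<exists>\<phi>. (\<forall>v. \<phi> v \<in> {1..Suc c}) \<and>
      (\<forall>i\<in>{1..Suc c}. k \<le> card {e \<in> E. e \<subseteq> U \<and> (\<forall>v\<in>e. \<phi> v = i)})" if "packs (Suc c) k E U" for U
    using that
  proof (induction c arbitrary: U)
    case 0
    then obtain W where "W \<subseteq> U" "k \<le> card (induced E W)" by auto
    then have "k \<le> card (induced E U)" using card_induced_mono[OF fE] le_trans by blast
    then show ?case by (intro exI[of _ "\<lambda>_. 1"]) (simp add: induced_def)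
  next
    case (Suc c)
    then obtain W where W: "W \<subseteq> U" "k \<le> card (induced E W)" "packs (Suc c) k E (U - W)"
      by (metis packs.simps(2))
    from Suc.IH[OF W(3)] obtain \<phi> where \<phi>: "\<forall>v. \<phi> v \<in> {1..Suc c}"
      "\<forall>i\<in>{1..Suc c}. k \<le> card {e \<in> E. e \<subseteq> U - W \<and> (\<forall>v\<in>e. \<phi> v = i)}" by blast
    define \<psi> where "\<psi> v = (if v \<in> W then Suc (Suc c) else \<phi> v)" for v
    have "k \<le> card {e \<in> E. e \<subseteq> U \<and> (\<forall>v\<in>e. \<psi> v = i)}" if "i \<in> {1..Suc (Suc c)}" for i
    proof (cases "i = Suc (Suc c)")
      case True
      have "induced E W \<subseteq> {e \<in> E. e \<subseteq> U \<and> (\<forall>v\<in>e. \<psi> v = i)}"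
        using W(1) True by (auto simp: induced_def \<psi>_def)
      then have "card (induced E W) \<le> card {e \<in> E. e \<subseteq> U \<and> (\<forall>v\<in>e. \<psi> v = i)}"
        using fE by (intro card_mono) auto
      then show ?thesis using W(2) by linarith
    next
      case False
      then have "k \<le> card {e \<in> E. e \<subseteq> U - W \<and> (\<forall>v\<in>e. \<phi> v = i)}" using \<phi>(2) that by auto
      also have "\<dots> \<le> card {e \<in> E. e \<subseteq> U \<and> (\<forall>v\<in>e. \<psi> v = i)}"
        by (rule card_mono) (use fE in \<open>auto simp: \<psi>_def\<close>)
      finally show ?thesis .
    qed
    moreover have "\<forall>v. \<psi> v \<in> {1..Suc (Suc c)}" using \<phi>(1) by (auto simp: \<psi>_def le_SucI)
    ultimately show ?case by blast
  qed
  moreover assume "packs (Suc c) k E V"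
  ultimately obtain \<phi> where \<phi>: "\<forall>v. \<phi> v \<in> {1..Suc c}"
      "\<forall>i\<in>{1..Suc c}. k \<le> card {e \<in> E. e \<subseteq> V \<and> (\<forall>v\<in>e. \<phi> v = i)}" by blast
  have "{e \<in> E. e \<subseteq> V \<and> (\<forall>v\<in>e. \<phi> v = i)} = {e \<in> E. \<forall>v\<in>e. \<phi> v = i}" for i
    using V by (auto simp: simple_graph_def)
  with \<phi> show "LCP (Suc c) k V E" unfolding LCP_def by (intro exI[of _ \<phi>]) auto
qed

text \<open>By pigeonhole some color does not occur on \<open>S\<close>, and all edges of that color
  avoid \<open>S\<close>.\<close>

lemma LCP_le_induced:
  assumes "simple_graph V E" "LCP c k V E" "finite S" "card S < c"
  shows "k \<le> card (induced E (V - S))"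
proof -
  from assms(2) obtain \<phi> where \<phi>: "\<forall>i\<in>{1..c}. k \<le> card {e \<in> E. \<forall>v\<in>e. \<phi> v = i}"
    unfolding LCP_def by blast
  have "card (\<phi> ` S) < card {1..c}" using card_image_le[OF assms(3), of \<phi>] assms(4) by simp
  then obtain i where i: "i \<in> {1..c}" "i \<notin> \<phi> ` S"
    using assms(3) by (metis card_mono finite_imageI leD subsetI)
  have "{e \<in> E. \<forall>v\<in>e. \<phi> v = i} \<subseteq> induced E (V - S)"
    using assms(1) i(2) by (auto simp: induced_def simple_graph_def)
  moreover have "finite (induced E (V - S))"
    using assms(1) by (intro finite_induced simple_graph_finite_edges)
  ultimately show ?thesis using \<phi> i(1) by (meson card_mono le_trans)
qed

lemma LCP_mono: "LCP c k V E \<Longrightarrow> l \<le> k \<Longrightarrow> LCP c l V E"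
  unfolding LCP_def by (meson le_trans)

lemma LCP_0: "c > 0 \<Longrightarrow> LCP c 0 V E"
  unfolding LCP_def by (intro exI[of _ "\<lambda>_. 1"]) auto

lemma LCP_k_opt:
  assumes "c > 0" "simple_graph V E"
  shows "LCP c (k_opt c V E) V E"
proof -
  \<comment> \<open>Deleting nothing bounds every feasible \<open>k\<close> by the number of edges,
    so \<open>Max\<close> is taken over a finite set.\<close>
  have "{k. LCP c k V E} \<subseteq> {..card (induced E V)}"
    using LCP_le_induced[OF assms(2), of c _ "{}"] assms(1) by auto
  then have "finite {k. LCP c k V E}" by (rule finite_subset) simp
  then show ?thesis unfolding k_opt_def using LCP_0[OF assms(1)] Max_in by blast
qed

text \<open>The matching is a flat tuple of \<open>2 * c\<close> vertices, so that the enumeration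
  of such tuples serves both for matchings and for deletion sets.\<close>

definition is_matching :: "nat \<Rightarrow> 'a set set \<Rightarrow> (nat \<Rightarrow> 'a) \<Rightarrow> bool" where
  "is_matching c E w \<longleftrightarrow> inj_on w {..<2 * c} \<and> (\<forall>i<c. {w (2 * i), w (2 * i + 1)} \<in> E)"

text \<open>Edges chosen from different color classes are disjoint; conversely, each matching edge
  can be given its own color.\<close>

lemma LCP_1_iff_matching:
  assumes "c > 0" "simple_graph V E"
  shows "LCP c 1 V E \<longleftrightarrow> (\<exists>w. w ` {..<2 * c} \<subseteq> V \<and> is_matching c E w)"
proof
  assume "LCP c 1 V E"
  then obtain \<phi> where \<phi>: "\<forall>i\<in>{1..c}. 1 \<le> card {e \<in> E. \<forall>v\<in>e. \<phi> v = i}"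
    unfolding LCP_def by blast
  have "\<exists>e. e \<in> E \<and> (\<forall>v\<in>e. \<phi> v = Suc i)" if "i < c" for i
  proof -
    have "{e \<in> E. \<forall>v\<in>e. \<phi> v = Suc i} \<noteq> {}"
      using \<phi>[rule_format, of "Suc i"] that by (metis One_nat_def Suc_leI atLeastAtMost_iff card.empty le_add2 not_one_le_zero plus_1_eq_Suc zero_less_Suc)
    then show ?thesis by blast
  qed
  then have "\<exists>x y. {x, y} \<in> E \<and> x \<noteq> y \<and> \<phi> x = Suc i \<and> \<phi> y = Suc i" if "i < c" for i
    using that assms(2) unfolding simple_graph_def by (metis card_2_iff insertCI)
  then obtain x y where xy: "\<And>i. i < c \<Longrightarrow> {x i, y i} \<in> E \<and> x i \<noteq> y i \<and> \<phi> (x i) = Suc i \<and> \<phi> (y i) = Suc i"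
    by metis
  define w where "w j = (if even j then x (j div 2) else y (j div 2))" for j
  have \<phi>w: "\<phi> (w j) = Suc (j div 2)" if "j < 2 * c" for j
    using that xy[of "j div 2"] by (auto simp: w_def)
  \<comment> \<open>The color determines the pair, and as the two ends of a pair differ, the parity
    of the position is determined too.\<close>
  have "inj_on w {..<2 * c}"
  proof (rule inj_onI)
    fix a b assume ab: "a \<in> {..<2 * c}" "b \<in> {..<2 * c}" "w a = w b"
    with \<phi>w[of a] \<phi>w[of b] have h: "a div 2 = b div 2" by simp
    have "a div 2 < c" using ab(1) by auto
    then have "even a = even b" using xy[of "a div 2"] ab(3) h unfolding w_def by (metis (full_types))
    with h show "a = b" by (metis bit_eq_rec even_iff_mod_2_eq_zero odd_iff_mod_2_eq_one mod_div_mult_eq)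
  qed
  moreover have "\<forall>i<c. {w (2 * i), w (2 * i + 1)} \<in> E" using xy by (auto simp: w_def)
  moreover have "w ` {..<2 * c} \<subseteq> V"
  proof (rule image_subsetI)
    fix j assume "j \<in> {..<2 * c}"
    then have "{x (j div 2), y (j div 2)} \<in> E" using xy[of "j div 2"] by auto
    then show "w j \<in> V" using assms(2) by (auto simp: w_def simple_graph_def)
  qed
  ultimately show "\<exists>w. w ` {..<2 * c} \<subseteq> V \<and> is_matching c E w" unfolding is_matching_def by blast
next
  assume "\<exists>w. w ` {..<2 * c} \<subseteq> V \<and> is_matching c E w"
  then obtain w where w: "inj_on w {..<2 * c}" "\<forall>i<c. {w (2 * i), w (2 * i + 1)} \<in> E"
    by (auto simp: is_matching_def)
  \<comment> \<open>Vertices off the matching get color 1; additional edges in a class do no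
    harm.\<close>
  define \<phi> where "\<phi> v = (if v \<in> w ` {..<2 * c} then Suc (the_inv_into {..<2 * c} w v div 2) else 1)" for v
  have \<phi>w: "\<phi> (w j) = Suc (j div 2)" if "j < 2 * c" for j
    using that w(1) by (simp add: \<phi>_def the_inv_into_f_f)
  have "\<phi> v \<in> {1..c}" for v
    using \<phi>w assms(1) by (cases "v \<in> w ` {..<2 * c}") (auto simp: \<phi>_def the_inv_into_f_f w(1))
  moreover have "1 \<le> card {e \<in> E. \<forall>v\<in>e. \<phi> v = i}" if "i \<in> {1..c}" for i
  proof -
    from that obtain j where j: "i = Suc j" "j < c" by (cases i) auto
    then have "{w (2 * j), w (2 * j + 1)} \<in> {e \<in> E. \<forall>v\<in>e. \<phi> v = i}"
      using w(2) \<phi>w[of "2 * j"] \<phi>w[of "2 * j + 1"] by simp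
    moreover have "finite {e \<in> E. \<forall>v\<in>e. \<phi> v = i}" using simple_graph_finite_edges[OF assms(2)] by simp
    ultimately have "0 < card {e \<in> E. \<forall>v\<in>e. \<phi> v = i}" unfolding card_gt_0_iff by blast
    then show ?thesis by simp
  qed
  ultimately show "LCP c 1 V E" unfolding LCP_def by (intro exI[of _ \<phi>]) auto
qed

section \<open>The approximation ratio\<close>

text \<open>At \<open>c = 2\<close> this is 48 against 52. From \<open>c\<close> to
  \<open>c + 1\<close> the left side grows by at most 12, the right side by
  \<open>2 * (16 * (c + 1) - 6)\<close>. For \<open>c = 1\<close> it fails, being 4 against
  1.\<close>

lemma ratio_ge:
  assumes "c \<ge> 2"
  shows "real (4 * c * 6 ^ (c - 1)) \<le> 2 ^ (c - 1) * P c"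
  using assms
proof (induction c rule: nat_induct_at_least)
  case base
  show ?case by (simp add: P_def K_def numeral_2_eq_2)
next
  case (Suc c)
  have P: "P (Suc c) = P c * (16 * real (Suc c) - 6)"
    using Suc.hyps by (simp add: P_def K_def power2_eq_square field_simps)
  have pw: "(x::real) ^ c = x * x ^ (c - 1)" for x
    using Suc.hyps by (metis One_nat_def Suc_1 Suc_leD Suc_pred power_Suc less_eq_Suc_le)
  have "real (4 * Suc c * 6 ^ (Suc c - 1)) \<le> real (4 * c * 6 ^ (c - 1)) * 12"
    using Suc.hyps by (simp add: pw algebra_simps)
  also have "\<dots> \<le> (2 ^ (c - 1) * P c) * (2 * (16 * real (Suc c) - 6))"
    using Suc.IH by (intro mult_mono order.trans[OF _ Suc.IH]) auto
  also have "\<dots> = 2 ^ (Suc c - 1) * P (Suc c)" by (simp add: P pw)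
  finally show ?case .
qed

text \<open>\<open>T\<close> is twice the least number of edges left after deleting fewer than
  \<open>c\<close> vertices, since the program counts arcs. With
  \<open>q = T div (2 * threshold c)\<close>, robustness yields \<open>q\<close> edges per color,
  while \<open>k_opt\<close> is below \<open>threshold c * (q + 1)\<close>. If \<open>q = 0\<close>,
  the flag \<open>F\<close> decides between 0 and 1.\<close>

lemma approximation_by_thresholds:
  assumes c: "c > 0" and V: "simple_graph V E"
    and le: "\<And>S. S \<subseteq> V \<Longrightarrow> card S < c \<Longrightarrow> T \<le> 2 * card (induced E (V - S))"
    and S: "finite S" "card S < c" "2 * card (induced E (V - S)) \<le> T"
    and F: "F = of_bool (LCP c 1 V E)"
    and k: "k = (if T div (2 * threshold c) = 0 then F else T div (2 * threshold c))"
  shows "LCP c k V E" and "real (k_opt c V E) \<le> 2 ^ (c - 1) * P c * real k"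
proof -
  define q where "q = T div (2 * threshold c)"
  have fin: "finite V" "finite E" "\<forall>e\<in>E. card e = 2"
    using V simple_graph_finite_edges by (auto simp: simple_graph_def)
  have pos: "threshold c > 0" by (simp add: threshold_def)
  have lo: "2 * (threshold c * q) \<le> T" unfolding q_def by (metis div_times_less_eq_dividend mult.assoc mult.commute)
  have hi: "T < 2 * threshold c * (q + 1)" unfolding q_def using pos
    by (metis Suc_eq_plus1 dividend_less_times_div mult_Suc_right nat_0_less_mult_iff zero_less_numeral)
  have opt: "2 * k_opt c V E \<le> T"
    using LCP_le_induced[OF V LCP_k_opt[OF c V] S(1,2)] S(3) by linarith
  show "LCP c k V E"
  proof (cases "q = 0")
    case True
    then have "k = of_bool (LCP c 1 V E)" using F k by (simp add: q_def)
    then show ?thesis using LCP_0[OF c] by (cases "LCP c 1 V E") auto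
  next
    case False
    have "packs c q E V"
    proof (rule packs_if_robust[OF fin(2,3) _ fin(1)])
      show "\<forall>S\<subseteq>V. card S < c \<longrightarrow> threshold c * q \<le> card (induced E (V - S))"
        using le lo by (meson dual_order.trans mult_le_cancel1 zero_less_numeral)
    qed (use False in simp)
    then show ?thesis using LCP_if_packs[OF V, of "c - 1" q] c False k by (simp add: q_def)
  qed
  show "real (k_opt c V E) \<le> 2 ^ (c - 1) * P c * real k"
  proof (cases "k = 0")
    case True
    then have "\<not> LCP c 1 V E" using k F by (auto split: if_splits)
    then have "k_opt c V E = 0" using LCP_mono[OF LCP_k_opt[OF c V], of 1] by linarith
    then show ?thesis using True by simp
  next
    case False
    show ?thesis
    proof (cases "c = 1")
      case True
      \<comment> \<open>With threshold 1 the quotient itself bounds \<open>k_opt\<close>, so the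
        ratio 1 is attained.\<close>
      then have t: "threshold c = 1" "2 ^ (c - 1) * P c = 1" by (simp_all add: threshold_def P_def K_def)
      then have "k_opt c V E \<le> q" using opt hi by simp
      moreover have "q \<le> k" using k by (simp add: q_def)
      ultimately show ?thesis unfolding t by simp
    next
      case c1: False
      with c have c2: "c \<ge> 2" by simp
      \<comment> \<open>Rounding costs a factor 2: either \<open>k = q \<ge> 1\<close>, or
        \<open>q = 0\<close> and \<open>k = 1\<close>.\<close>
      have "q + 1 \<le> 2 * k" using k False by (auto simp: q_def)
      then have "2 * threshold c * (q + 1) \<le> 2 * threshold c * (2 * k)" by (intro mult_le_mono) auto
      with hi opt have "k_opt c V E \<le> 2 * threshold c * k" by linarith
      moreover have "2 * threshold c \<le> 4 * c * 6 ^ (c - 1)"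
      proof -
        have "4 * c * (6 ^ (c - 1) - 1) + 4 * c = 4 * c * 6 ^ (c - 1)"
          by (simp add: diff_mult_distrib2)
        moreover have "2 * threshold c = 4 * c * (6 ^ (c - 1) - 1) + 2"
          by (simp add: threshold_def)
        ultimately show ?thesis using c2 by linarith
      qed
      ultimately have "k_opt c V E \<le> (4 * c * 6 ^ (c - 1)) * k" by (meson le_trans mult_le_mono1)
      then have "real (k_opt c V E) \<le> real (4 * c * 6 ^ (c - 1)) * real k"
        by (metis of_nat_le_iff of_nat_mult)
      also have "\<dots> \<le> 2 ^ (c - 1) * P c * real k" by (intro mult_right_mono ratio_ge c2) simp
      finally show ?thesis .
    qed
  qed
qed

section \<open>Reasoning about programs without stores\<close>

text \<open>Total correctness with a time bound. The memory is a fixed parameter, as it only holds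
  the input, so assertions speak of registers alone.\<close>

definition wp :: "(nat \<Rightarrow> nat) \<Rightarrow> nat \<Rightarrow> program \<Rightarrow> ((nat \<Rightarrow> nat) \<Rightarrow> bool) \<Rightarrow> (nat \<Rightarrow> nat) \<Rightarrow> bool" where
  "wp M B p Q R \<longleftrightarrow> (\<exists>t R'. t \<le> B \<and> exec p (R, M) t (R', M) \<and> Q R')"

lemma wp_mono:
  "wp M B p Q R \<Longrightarrow> (\<And>R'. Q R' \<Longrightarrow> Q' R') \<Longrightarrow> B \<le> B' \<Longrightarrow> wp M B' p Q' R"
  unfolding wp_def by (meson le_trans)

lemma wp_time: "wp M B p Q R \<Longrightarrow> B \<le> B' \<Longrightarrow> wp M B' p Q R"
  by (rule wp_mono)

lemma wp_Const: "Q (R(d := n)) \<Longrightarrow> wp M 1 (Const d n) Q R"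
  unfolding wp_def using exec.Const by blast

lemma wp_Add: "Q (R(d := R x + R y)) \<Longrightarrow> wp M 1 (Add d x y) Q R"
  unfolding wp_def using exec.Add by blast

lemma wp_Sub: "Q (R(d := R x - R y)) \<Longrightarrow> wp M 1 (Sub d x y) Q R"
  unfolding wp_def using exec.Sub by blast

lemma wp_Load: "Q (R(d := M (R a))) \<Longrightarrow> wp M 1 (Load d a) Q R"
  unfolding wp_def using exec.Load by blast

lemma wp_Seq: "wp M B p (wp M B' q Q) R \<Longrightarrow> wp M (B + B') (Seq p q) Q R"
  unfolding wp_def by (meson add_mono exec.Seq)

lemma wp_If:
  assumes "R x \<noteq> 0 \<Longrightarrow> wp M B p Q R" "R x = 0 \<Longrightarrow> wp M B' q Q R"
  shows "wp M (max B B' + 1) (If_Nonzero x p q) Q R"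
proof (cases "R x = 0")
  case True
  with assms(2) obtain t R' where "t \<le> B'" "exec q (R, M) t (R', M)" "Q R'"
    unfolding wp_def by blast
  with exec.If_False[of R x q M t "(R', M)" p] True show ?thesis
    unfolding wp_def by (intro exI[of _ "t + 1"] exI[of _ R']) auto
next
  case False
  with assms(1) obtain t R' where "t \<le> B" "exec p (R, M) t (R', M)" "Q R'"
    unfolding wp_def by blast
  with exec.If_True[of R x p M t "(R', M)" q] False show ?thesis
    unfolding wp_def by (intro exI[of _ "t + 1"] exI[of _ R']) auto
qed

lemmas wp_intros = wp_Seq wp_Const wp_Add wp_Sub wp_Load wp_If

text \<open>The invariant is indexed by the number of rounds still to come, which gives termination
  and the time bound at once.\<close>

lemma wp_While:
  assumes step: "\<And>i R. I (Suc i) R \<Longrightarrow> R x \<noteq> 0 \<and> wp M B p (I i) R"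
    and exit: "\<And>R. I 0 R \<Longrightarrow> R x = 0"
  shows "I m R \<Longrightarrow> wp M (m * (B + 1) + 1) (While_Nonzero x p) (I 0) R"
proof (induction m arbitrary: R)
  case 0
  with exec.While_False[of R x p M] exit[OF 0] show ?case
    unfolding wp_def by (intro exI[of _ 1] exI[of _ R]) auto
next
  case (Suc m)
  from step[OF Suc.prems] obtain t R' where 1: "R x \<noteq> 0" "t \<le> B" "exec p (R, M) t (R', M)" "I m R'"
    unfolding wp_def by blast
  from Suc.IH[OF 1(4)] obtain u R'' where 2: "u \<le> m * (B + 1) + 1"
      "exec (While_Nonzero x p) (R', M) u (R'', M)" "I 0 R''"
    unfolding wp_def by blast
  have "exec (While_Nonzero x p) (R, M) (t + u + 1) (R'', M)"
    using 1(1,3) 2(2) by (rule exec.While_True)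
  moreover have "t + u + 1 \<le> Suc m * (B + 1) + 1" using 1(2) 2(1) by simp
  ultimately show ?case using 2(3) unfolding wp_def by blast
qed

text \<open>
  Register use: 0 output (zero until the final division), 1 the number of vertices, 2 the constant one,
  3 truth value of tests, 4 and 5 scratch, 6 and 7 counters, 8 arc count, 9 the minimal arc count so
  far, 10 whether a matching was found, 12 onwards the current tuple. Since \<open>countdown\<close> runs its counter
  from \<open>n\<close> to 1, vertex \<open>v\<close> is represented by \<open>v + 1\<close>.
\<close>

definition skip :: program where
  "skip = Const 4 0"

definition countdown :: "nat \<Rightarrow> program \<Rightarrow> program" where
  "countdown x p = While_Nonzero x (Seq p (Sub x x 2))"

text \<open>The decrement is part of the postcondition of the body, so the body sees the counter at
  \<open>Suc i\<close> and must establish the invariant for \<open>i\<close>. A round costs two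
  extra steps, the decrement and the loop test.\<close>

lemma wp_countdown:
  assumes "\<And>i R. I (Suc i) R \<Longrightarrow> wp M B p (\<lambda>R'. I i (R'(x := R' x - R' 2))) R"
    and "\<And>i R. I i R \<Longrightarrow> R x = i"
  shows "I m R \<Longrightarrow> wp M (m * (B + 2) + 1) (countdown x p) (I 0) R"
proof -
  assume "I m R"
  moreover have "R x \<noteq> 0 \<and> wp M (B + 1) (Seq p (Sub x x 2)) (I i) R" if "I (Suc i) R" for i R
  proof
    show "wp M (B + 1) (Seq p (Sub x x 2)) (I i) R"
      by (rule wp_Seq, rule wp_mono[OF assms(1)[OF that]]) (auto intro: wp_Sub[unfolded One_nat_def])
  qed (use assms(2)[OF that] in simp)
  ultimately have "wp M (m * (B + 1 + 1) + 1) (While_Nonzero x (Seq p (Sub x x 2))) (I 0) R"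
    using assms(2) by (rule wp_While[rotated 2])
  then show ?thesis by (simp add: countdown_def)
qed

section \<open>The program\<close>

datatype test = Distinct nat nat | Adjacent nat nat

text \<open>Two numbers are equal iff both truncated differences vanish. The address of a matrix
  entry is computed by repeatedly adding \<open>n\<close>. A failed test clears register 3 and a
  passed one keeps it, so consecutive tests form a conjunction. Adding register 0, which is still
  zero, copies a register.\<close>

fun test_program :: "test \<Rightarrow> program" where
  "test_program (Distinct a b) =
    Seq (Sub 4 a b) (Seq (Sub 5 b a) (Seq (Add 4 4 5) (If_Nonzero 4 skip (Const 3 0))))"
| "test_program (Adjacent a b) =
    Seq (Add 5 b 0) (Seq (Sub 4 a 2) (Seq (countdown 4 (Add 5 5 1))
      (Seq (Load 4 5) (If_Nonzero 4 skip (Const 3 0)))))"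

fun holds :: "(nat \<Rightarrow> nat \<Rightarrow> bool) \<Rightarrow> (nat \<Rightarrow> nat) \<Rightarrow> test \<Rightarrow> bool" where
  "holds adj R (Distinct a b) = (R a \<noteq> R b)"
| "holds adj R (Adjacent a b) = adj (R a) (R b)"

text \<open>Registers from 6 on are not touched by tests, and the range conditions make the matrix
  address valid.\<close>

fun admissible :: "nat \<Rightarrow> (nat \<Rightarrow> nat) \<Rightarrow> test \<Rightarrow> bool" where
  "admissible n R (Distinct a b) = (6 \<le> a \<and> 6 \<le> b)"
| "admissible n R (Adjacent a b) = (6 \<le> a \<and> 6 \<le> b \<and> R a \<in> {1..n} \<and> R b \<in> {1..n})"

fun check :: "test list \<Rightarrow> program" where
  "check [] = skip"
| "check (t # ts) = Seq (test_program t) (check ts)"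

definition tuple :: "(nat \<Rightarrow> nat) \<Rightarrow> nat \<Rightarrow> nat" where
  "tuple R i = R (12 + i)"

definition matching_tests :: "nat \<Rightarrow> test list" where
  "matching_tests c = map (\<lambda>i. Adjacent (12 + 2 * i) (12 + (2 * i + 1))) [0..<c] @
    concat (map (\<lambda>p. map (\<lambda>q. Distinct (12 + p) (12 + q)) [0..<p]) [0..<2 * c])"

text \<open>The first \<open>c - 1\<close> entries of the tuple act as deleted vertices; repeated
  entries account for smaller sets.\<close>

definition arc_tests :: "nat \<Rightarrow> test list" where
  "arc_tests c = Adjacent 6 7 # map (\<lambda>p. Distinct 6 (12 + p)) [0..<c - 1] @ map (\<lambda>p. Distinct 7 (12 + p)) [0..<c - 1]"

definition count_arcs :: "nat \<Rightarrow> program" where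
  "count_arcs c = Seq (Const 8 0) (Seq (Add 6 1 0) (countdown 6 (Seq (Add 7 1 0) (countdown 7
    (Seq (Const 3 1) (Seq (check (arc_tests c)) (Add 8 8 3)))))))"

text \<open>The two final subtractions compute a minimum: \<open>x - (x - y) = min x y\<close> for
  truncated subtraction.\<close>

definition process_tuple :: "nat \<Rightarrow> program" where
  "process_tuple c = Seq (Const 3 1) (Seq (check (matching_tests c))
    (Seq (If_Nonzero 3 (Const 10 1) skip) (Seq (count_arcs c) (Seq (Sub 8 9 8) (Sub 9 9 8)))))"

text \<open>As \<open>c\<close> is fixed, the loops can be nested statically, with the last position
  outermost.\<close>

fun all_tuples :: "program \<Rightarrow> nat \<Rightarrow> program" where
  "all_tuples p 0 = p"
| "all_tuples p (Suc j) = Seq (Add (12 + j) 1 0) (countdown (12 + j) (all_tuples p j))"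

text \<open>Register 9 starts at \<open>n * n\<close>, an upper bound for every arc count. The last
  loop divides by repeated subtraction; the one added beforehand makes register 6 nonzero exactly
  while a further subtraction is possible. A zero quotient is replaced by the matching flag.\<close>

definition load_coloring :: "nat \<Rightarrow> program" where
  "load_coloring c = Seq (Load 1 0) (Seq (Const 2 1) (Seq (Add 6 1 0) (Seq (countdown 6 (Add 9 9 1))
    (Seq (all_tuples (process_tuple c) (2 * c))
    (Seq (Const 7 (2 * threshold c)) (Seq (Add 6 9 2) (Seq (Sub 6 6 7)
    (Seq (While_Nonzero 6 (Seq (Add 0 0 2) (Sub 6 6 7)))
    (If_Nonzero 0 skip (Add 0 0 10))))))))))"

section \<open>Enumerated tuples and time bounds\<close>

text \<open>These are the tuples visited by the innermost \<open>j\<close> loops while the outer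
  positions stay at \<open>w\<close>.\<close>

definition tuples :: "nat \<Rightarrow> nat \<Rightarrow> (nat \<Rightarrow> nat) \<Rightarrow> (nat \<Rightarrow> nat) set" where
  "tuples n j w = {u. (\<forall>i<j. u i \<in> {1..n}) \<and> (\<forall>i\<ge>j. u i = w i)}"

lemma tuples_0: "tuples n 0 w = {w}"
  by (auto simp: tuples_def)

lemma tuples_Suc: "tuples n (Suc j) w = (\<Union>m\<in>{0<..n}. tuples n j (w(j := m)))"
proof (intro set_eqI iffI)
  fix u assume u: "u \<in> tuples n (Suc j) w"
  then have "u j \<in> {0<..n}" by (auto simp: tuples_def)
  moreover have "u \<in> tuples n j (w(j := u j))"
    using u by (auto simp: tuples_def less_Suc_eq)
  ultimately show "u \<in> (\<Union>m\<in>{0<..n}. tuples n j (w(j := m)))" by blast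
next
  fix u assume "u \<in> (\<Union>m\<in>{0<..n}. tuples n j (w(j := m)))"
  then show "u \<in> tuples n (Suc j) w" by (fastforce simp: tuples_def less_Suc_eq Suc_le_eq)
qed

fun tuples_time :: "nat \<Rightarrow> nat \<Rightarrow> nat \<Rightarrow> nat" where
  "tuples_time B n 0 = B"
| "tuples_time B n (Suc j) = 1 + (n * (tuples_time B n j + 2) + 1)"

definition test_time :: "nat \<Rightarrow> nat" where
  "test_time n = 3 * n + 10"

definition check_time :: "nat \<Rightarrow> test list \<Rightarrow> nat" where
  "check_time n ts = length ts * test_time n + 1"

definition count_time :: "nat \<Rightarrow> nat \<Rightarrow> nat" where
  "count_time n c = 3 + n * (4 + n * (4 + check_time n (arc_tests c)))"

definition process_time :: "nat \<Rightarrow> nat \<Rightarrow> nat" where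
  "process_time n c = 5 + check_time n (matching_tests c) + count_time n c"

definition total_time :: "nat \<Rightarrow> nat \<Rightarrow> nat" where
  "total_time n c = 12 + n * 3 + tuples_time (process_time n c) n (2 * c) + n * n * 3"

section \<open>Correctness of the program\<close>

text \<open>Registers number vertices from 1, and the entry \<open>n\<close> at address 0 shifts the
  matrix by one as well; hence the address \<open>(i - 1) * n + j\<close>.\<close>

locale graph_memory =
  fixes M :: "nat \<Rightarrow> nat" and n :: nat and adj :: "nat \<Rightarrow> nat \<Rightarrow> bool"
  assumes size: "M 0 = n"
    and matrix: "\<And>i j. i \<in> {1..n} \<Longrightarrow> j \<in> {1..n} \<Longrightarrow> M ((i - 1) * n + j) = of_bool (adj i j)"
begin

definition ready :: "(nat \<Rightarrow> nat) \<Rightarrow> bool" where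
  "ready R \<longleftrightarrow> R 0 = 0 \<and> R 1 = n \<and> R 2 = 1"

lemma wp_test:
  assumes "ready R" "admissible n R t"
  shows "wp M (test_time n) (test_program t) (\<lambda>R'. R' 3 = (if holds adj R t then R 3 else 0) \<and>
    (\<forall>r. r \<notin> {3, 4, 5} \<longrightarrow> R' r = R r)) R"
proof (cases t)
  case (Distinct a b)
  then show ?thesis using assms
    apply (simp only: test_program.simps skip_def)
    apply (rule wp_time)
     apply (rule wp_intros)+
       apply (auto simp: test_time_def)[1]
      apply (rule wp_intros)+
      apply (auto simp: test_time_def)
    done
next
  case (Adjacent a b)
  \<comment> \<open>Register 4 counts the rows still to be skipped, register 5 accumulates the
    address.\<close>
  define I where "I i R' \<longleftrightarrow> R' 4 = i \<and> R' 5 = R b + (R a - 1 - i) * n \<and> i \<le> R a - 1 \<and>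
    (\<forall>r. r \<notin> {4, 5} \<longrightarrow> R' r = R r)" for i and R' :: "nat \<Rightarrow> nat"
  have ab: "6 \<le> a" "6 \<le> b" "R a \<in> {1..n}" "R b \<in> {1..n}" using assms(2) Adjacent by auto
  have step: "wp M 1 (Add 5 5 1) (\<lambda>R''. I i (R''(4 := R'' 4 - R'' 2))) R'" if "I (Suc i) R'" for i R'
  proof (rule wp_Add)
    have "R a - Suc 0 - i = Suc (R a - Suc 0 - Suc i)" using that by (auto simp: I_def)
    then show "I i ((R'(5 := R' 5 + R' 1))(4 := (R'(5 := R' 5 + R' 1)) 4 - (R'(5 := R' 5 + R' 1)) 2))"
      using that assms(1) by (auto simp: I_def ready_def)
  qed
  have loop: "wp M ((R a - 1) * (1 + 2) + 1) (countdown 4 (Add 5 5 1)) (I 0) R'" if "I (R a - 1) R'" for R'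
    by (rule wp_countdown[of I, OF step _ that]) (auto simp: I_def)
  have addr: "M (R b + (R a - 1) * n) = of_bool (adj (R a) (R b))"
    using matrix[OF ab(3,4)] by (simp add: add.commute)
  have tail: "wp M 4 (Seq (Load 4 5) (If_Nonzero 4 skip (Const 3 0)))
    (\<lambda>R'. R' 3 = (if holds adj R t then R 3 else 0) \<and> (\<forall>r. r \<notin> {3, 4, 5} \<longrightarrow> R' r = R r)) R'"
    if "I 0 R'" for R'
    unfolding skip_def using that ab addr
    apply (rule_tac wp_time)
     apply (rule wp_intros)+
      apply (auto simp: I_def Adjacent)[1]
     apply (rule wp_intros)+
     apply (auto simp: I_def Adjacent)
    done
  have start: "I (R a - 1) (R(5 := R b + R 0, 4 := (R(5 := R b + R 0)) a - (R(5 := R b + R 0)) 2))"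
    using ab assms(1) by (auto simp: I_def ready_def)
  have "wp M (1 + (1 + ((R a - 1) * (1 + 2) + 1 + 4))) (test_program (Adjacent a b))
    (\<lambda>R'. R' 3 = (if holds adj R t then R 3 else 0) \<and> (\<forall>r. r \<notin> {3, 4, 5} \<longrightarrow> R' r = R r)) R"
    unfolding test_program.simps
    by (rule wp_Seq, rule wp_Add, rule wp_Seq, rule wp_Sub, rule wp_Seq,
        rule wp_mono[OF loop[OF start] tail order_refl])
  moreover have "1 + (1 + ((R a - 1) * (1 + 2) + 1 + 4)) \<le> test_time n"
    using ab(3) by (simp add: test_time_def)
  ultimately show ?thesis unfolding Adjacent[symmetric] by (rule wp_time)
qed

lemma wp_check:
  "\<lbrakk>ready R; \<forall>t\<in>set ts. admissible n R t\<rbrakk> \<Longrightarrow>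
    wp M (check_time n ts) (check ts) (\<lambda>R'. R' 3 = (if \<forall>t\<in>set ts. holds adj R t then R 3 else 0) \<and>
      (\<forall>r. r \<notin> {3, 4, 5} \<longrightarrow> R' r = R r)) R"
proof (induction ts arbitrary: R)
  case Nil
  show ?case unfolding check.simps skip_def check_time_def by (rule wp_time, rule wp_Const) auto
next
  case (Cons t ts)
  have tl: "wp M (check_time n ts) (check ts) (\<lambda>R''. R'' 3 = (if \<forall>t\<in>set (t # ts). holds adj R t then R 3 else 0) \<and>
      (\<forall>r. r \<notin> {3, 4, 5} \<longrightarrow> R'' r = R r)) R'"
    if R': "R' 3 = (if holds adj R t then R 3 else 0) \<and> (\<forall>r. r \<notin> {3, 4, 5} \<longrightarrow> R' r = R r)" for R'
  proof -
    \<comment> \<open>The remaining tests read only registers from 6 on, which the first test left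
      unchanged.\<close>
    have same: "admissible n R' s" "holds adj R' s \<longleftrightarrow> holds adj R s" if "s \<in> set ts" for s
      using Cons.prems(2) that R' by (cases s; fastforce)+
    have "ready R'" using Cons.prems(1) R' by (auto simp: ready_def)
    from Cons.IH[OF this] have "wp M (check_time n ts) (check ts)
      (\<lambda>S. S 3 = (if \<forall>t\<in>set ts. holds adj R' t then R' 3 else 0) \<and> (\<forall>r. r \<notin> {3, 4, 5} \<longrightarrow> S r = R' r)) R'"
      using same(1) by blast
    then show ?thesis
      by (rule wp_mono) (use R' same(2) in auto)
  qed
  show ?case unfolding check.simps
    by (rule wp_time, rule wp_Seq, rule wp_mono[OF wp_test tl order_refl])
      (use Cons.prems in \<open>auto simp: check_time_def\<close>)
qed

text \<open>The ranges fit the counters: a counter running down from \<open>n\<close> has dealt with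
  \<open>{i<..n}\<close> when it reaches \<open>i\<close>.\<close>

definition removal_arcs :: "nat \<Rightarrow> (nat \<Rightarrow> nat) \<Rightarrow> nat" where
  "removal_arcs c w = (\<Sum>i\<in>{0<..n}. \<Sum>j\<in>{0<..n}.
    of_bool (adj i j \<and> i \<notin> w ` {..<c - 1} \<and> j \<notin> w ` {..<c - 1}))"

definition matched :: "nat \<Rightarrow> (nat \<Rightarrow> nat) \<Rightarrow> bool" where
  "matched c w \<longleftrightarrow> inj_on w {..<2 * c} \<and> (\<forall>i<c. adj (w (2 * i)) (w (2 * i + 1)))"

lemma arc_tests_hold:
  "(\<forall>t\<in>set (arc_tests c). holds adj R t) \<longleftrightarrow>
    adj (R 6) (R 7) \<and> R 6 \<notin> tuple R ` {..<c - 1} \<and> R 7 \<notin> tuple R ` {..<c - 1}"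
  by (simp add: arc_tests_def tuple_def ball_Un) (auto simp: image_iff)

lemma matching_tests_hold:
  "(\<forall>t\<in>set (matching_tests c). holds adj R t) \<longleftrightarrow> matched c (tuple R)"
proof -
  have "inj_on (tuple R) {..<2 * c} \<longleftrightarrow> (\<forall>p<2 * c. \<forall>q<p. R (12 + p) \<noteq> R (12 + q))"
  proof
    assume inj: "inj_on (tuple R) {..<2 * c}"
    show "\<forall>p<2 * c. \<forall>q<p. R (12 + p) \<noteq> R (12 + q)"
    proof (intro allI impI notI)
      fix p q assume "p < 2 * c" "q < p" "R (12 + p) = R (12 + q)"
      with inj_onD[OF inj, of p q] show False by (simp add: tuple_def)
    qed
  next
    assume "\<forall>p<2 * c. \<forall>q<p. R (12 + p) \<noteq> R (12 + q)"
    then show "inj_on (tuple R) {..<2 * c}"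
      by (intro linorder_inj_onI') (metis lessThan_iff tuple_def)
  qed
  then show ?thesis
    unfolding matched_def by (simp add: matching_tests_def tuple_def ball_Un) (auto simp: Ball_def)
qed

lemma wp_count:
  assumes R: "ready R"
  shows "wp M (count_time n c) (count_arcs c) (\<lambda>R'. R' 8 = removal_arcs c (tuple R) \<and>
    (\<forall>r. r \<notin> {3..8} \<longrightarrow> R' r = R r)) R"
proof -
  define a :: "nat \<Rightarrow> nat \<Rightarrow> nat" where
    "a i j = of_bool (adj i j \<and> i \<notin> tuple R ` {..<c - 1} \<and> j \<notin> tuple R ` {..<c - 1})" for i j
  \<comment> \<open>\<open>b\<close> is the count when the row of \<open>i\<close> was entered; the
    sum is what this row has contributed so far.\<close>
  define J where "J b i j R' \<longleftrightarrow> R' 6 = i \<and> R' 7 = j \<and> i \<in> {1..n} \<and> j \<le> n \<and> R' 8 = b + (\<Sum>j'\<in>{j<..n}. a i j') \<and>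
    (\<forall>r. r \<notin> {3..8} \<longrightarrow> R' r = R r)" for b i j :: nat and R' :: "nat \<Rightarrow> nat"
  define I where "I i R' \<longleftrightarrow> R' 6 = i \<and> i \<le> n \<and> R' 8 = (\<Sum>i'\<in>{i<..n}. \<Sum>j\<in>{0<..n}. a i' j) \<and>
    (\<forall>r. r \<notin> {3..8} \<longrightarrow> R' r = R r)" for i :: nat and R' :: "nat \<Rightarrow> nat"
  have split: "{i<..n} = insert (Suc i) {Suc i<..n}" if "Suc i \<le> n" for i using that by auto
  have inner: "wp M (check_time n (arc_tests c) + 2) (Seq (Const 3 1) (Seq (check (arc_tests c)) (Add 8 8 3)))
      (\<lambda>R'. J b i j (R'(7 := R' 7 - R' 2))) R'" if J: "J b i (Suc j) R'" for b i j R'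
  proof -
    let ?R = "R'(3 := 1)"
    have rd: "ready ?R" using J R by (auto simp: J_def ready_def)
    have tup: "tuple ?R = tuple R" using J by (auto simp: J_def tuple_def)
    have adm: "\<forall>t\<in>set (arc_tests c). admissible n ?R t"
      using J by (auto simp: J_def arc_tests_def)
    have hold: "(\<forall>t\<in>set (arc_tests c). holds adj ?R t) \<longleftrightarrow> a i (Suc j) = 1"
      using J unfolding arc_tests_hold tup by (auto simp: J_def a_def)
    have a01: "a i (Suc j) = 0 \<or> a i (Suc j) = 1" by (simp add: a_def)
    have fin: "J b i j (R''(8 := R'' 8 + R'' 3, 7 := (R''(8 := R'' 8 + R'' 3)) 7 - (R''(8 := R'' 8 + R'' 3)) 2))"
      if R'': "R'' 3 = (if \<forall>t\<in>set (arc_tests c). holds adj ?R t then ?R 3 else 0) \<and>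
        (\<forall>r. r \<notin> {3, 4, 5} \<longrightarrow> R'' r = ?R r)" for R''
    proof -
      have 3: "R'' 3 = a i (Suc j)" using R'' a01 unfolding hold by auto
      have 2: "R'' 2 = 1" using R'' rd by (auto simp: ready_def)
      show ?thesis using J R'' 3 2 by (auto simp: J_def split[of j])
    qed
    have "wp M 1 (Add 8 8 3) (\<lambda>R'. J b i j (R'(7 := R' 7 - R' 2))) R''"
      if "R'' 3 = (if \<forall>t\<in>set (arc_tests c). holds adj ?R t then ?R 3 else 0) \<and>
        (\<forall>r. r \<notin> {3, 4, 5} \<longrightarrow> R'' r = ?R r)" for R''
      by (rule wp_Add) (rule fin[OF that])
    then have "wp M (1 + (check_time n (arc_tests c) + 1)) (Seq (Const 3 1) (Seq (check (arc_tests c)) (Add 8 8 3)))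
        (\<lambda>R'. J b i j (R'(7 := R' 7 - R' 2))) R'"
      by (intro wp_Seq wp_Const) (rule wp_mono[OF wp_check[OF rd adm] _ order_refl])
    then show ?thesis by (simp add: add.commute)
  qed
  have outer: "wp M (1 + (n * (check_time n (arc_tests c) + 2 + 2) + 1)) (Seq (Add 7 1 0) (countdown 7
      (Seq (Const 3 1) (Seq (check (arc_tests c)) (Add 8 8 3)))))
      (\<lambda>R'. I i (R'(6 := R' 6 - R' 2))) R'" if I: "I (Suc i) R'" for i R'
  proof (rule wp_Seq, rule wp_Add)
    have start: "J (R' 8) (Suc i) n (R'(7 := R' 1 + R' 0))"
      using I R by (auto simp: I_def J_def ready_def)
    have "wp M (n * (check_time n (arc_tests c) + 2 + 2) + 1) (countdown 7 (Seq (Const 3 1) (Seq (check (arc_tests c)) (Add 8 8 3))))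
        (J (R' 8) (Suc i) 0) (R'(7 := R' 1 + R' 0))"
      by (rule wp_countdown[of "J (R' 8) (Suc i)", OF inner _ start]) (auto simp: J_def)
    then show "wp M (n * (check_time n (arc_tests c) + 2 + 2) + 1) (countdown 7 (Seq (Const 3 1) (Seq (check (arc_tests c)) (Add 8 8 3))))
        (\<lambda>R'. I i (R'(6 := R' 6 - R' 2))) (R'(7 := R' 1 + R' 0))"
      by (rule wp_mono) (use I R in \<open>auto simp: I_def J_def ready_def split[of i]\<close>)
  qed
  have loop: "wp M (n * (1 + (n * (check_time n (arc_tests c) + 2 + 2) + 1) + 2) + 1) (countdown 6 (Seq (Add 7 1 0) (countdown 7
      (Seq (Const 3 1) (Seq (check (arc_tests c)) (Add 8 8 3)))))) (I 0) R'" if "I n R'" for R'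
    by (rule wp_countdown[of I, OF outer _ that]) (auto simp: I_def)
  have start: "I n (R(8 := 0, 6 := (R(8 := 0)) 1 + (R(8 := 0)) 0))"
    using R by (auto simp: I_def ready_def)
  show ?thesis unfolding count_arcs_def
    by (rule wp_time, rule wp_Seq, rule wp_Const, rule wp_Seq, rule wp_Add, rule wp_mono[OF loop[OF start] _ order_refl])
      (auto simp: I_def removal_arcs_def a_def count_time_def algebra_simps)
qed

text \<open>Register 9 is the minimum of \<open>n * n\<close> and the counts over \<open>W\<close>.
  Including the initial value \<open>n * n\<close> covers the empty \<open>W\<close>.\<close>

definition summary :: "nat \<Rightarrow> (nat \<Rightarrow> nat) set \<Rightarrow> (nat \<Rightarrow> nat) \<Rightarrow> bool" where
  "summary c W R \<longleftrightarrow> R 9 \<le> n * n \<and> (\<forall>w\<in>W. R 9 \<le> removal_arcs c w) \<and>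
    (R 9 = n * n \<or> (\<exists>w\<in>W. R 9 = removal_arcs c w)) \<and> R 10 = of_bool (\<exists>w\<in>W. matched c w)"

lemma wp_process_tuple:
  assumes R: "ready R" "\<forall>i<2 * c. tuple R i \<in> {1..n}" "summary c W R"
  shows "wp M (process_time n c) (process_tuple c) (\<lambda>R'. summary c (insert (tuple R) W) R' \<and>
    ready R' \<and> tuple R' = tuple R) R"
proof -
  have adm: "\<forall>t\<in>set (matching_tests c). admissible n (R(3 := 1)) t"
  proof -
    have "R (12 + i) \<in> {1..n}" if "i < 2 * c" for i using R(2) that by (auto simp: tuple_def)
    from this[of "2 * _"] this[of "2 * _ + 1"] show ?thesis
      by (auto simp: matching_tests_def)
  qed
  have rd: "ready (R(3 := 1))" using R(1) by (auto simp: ready_def)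
  have tup: "tuple (R(3 := 1)) = tuple R" by (auto simp: tuple_def)
  let ?Q = "\<lambda>R'. summary c (insert (tuple R) W) R' \<and> ready R' \<and> tuple R' = tuple R"
  \<comment> \<open>\<open>S\<close> is the state after the matching flag was updated,
    \<open>R'\<close> the state after counting.\<close>
  have fin: "wp M (1 + 1) (Seq (Sub 8 9 8) (Sub 9 9 8)) ?Q R'"
    if R': "R' 8 = removal_arcs c (tuple R) \<and> (\<forall>r. r \<notin> {3..8} \<longrightarrow> R' r = S r)"
      and S: "S 10 = (if matched c (tuple R) then 1 else R 10)" "\<forall>r. r \<notin> {3, 4, 5, 10} \<longrightarrow> S r = R r" for R' S
    using R' S R
    by (intro wp_Seq wp_Sub) (auto simp: summary_def ready_def tuple_def fun_eq_iff)
  have mid: "wp M (2 + (count_time n c + (1 + 1))) (Seq (If_Nonzero 3 (Const 10 1) skip) (Seq (count_arcs c) (Seq (Sub 8 9 8) (Sub 9 9 8)))) ?Q R'"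
    if R': "R' 3 = (if \<forall>t\<in>set (matching_tests c). holds adj (R(3 := 1)) t then (R(3 := 1)) 3 else 0) \<and>
      (\<forall>r. r \<notin> {3, 4, 5} \<longrightarrow> R' r = (R(3 := 1)) r)" for R'
  proof (rule wp_Seq)
    have R'3: "R' 3 = of_bool (matched c (tuple R))" using R' unfolding matching_tests_hold tup by auto
    have "wp M (max 1 1 + 1) (If_Nonzero 3 (Const 10 1) (Const 4 0)) (\<lambda>S. S 10 = (if matched c (tuple R) then 1 else R 10) \<and>
        (\<forall>r. r \<notin> {3, 4, 5, 10} \<longrightarrow> S r = R r)) R'"
      by (intro wp_If wp_Const) (use R' R'3 in auto)
    then show "wp M 2 (If_Nonzero 3 (Const 10 1) skip) (wp M (count_time n c + (1 + 1)) (Seq (count_arcs c) (Seq (Sub 8 9 8) (Sub 9 9 8))) ?Q) R'"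
      unfolding skip_def
    proof (rule wp_mono)
      fix S assume S: "S 10 = (if matched c (tuple R) then 1 else R 10) \<and> (\<forall>r. r \<notin> {3, 4, 5, 10} \<longrightarrow> S r = R r)"
      have "ready S" using S R(1) by (auto simp: ready_def)
      moreover have "tuple S = tuple R" using S by (auto simp: tuple_def)
      ultimately show "wp M (count_time n c + (1 + 1)) (Seq (count_arcs c) (Seq (Sub 8 9 8) (Sub 9 9 8))) ?Q S"
        using S by (intro wp_Seq wp_mono[OF wp_count fin[where S = S] order_refl]) auto
    qed simp
  qed
  show ?thesis unfolding process_tuple_def
    by (rule wp_time, rule wp_Seq, rule wp_Const, rule wp_Seq, rule wp_mono[OF wp_check[OF rd adm] mid order_refl])
      (auto simp: process_time_def)
qed

text \<open>\<open>W\<close> holds the tuples treated before. It is arbitrary in the induction, so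
  each run of the inner loops extends the summary of all previous runs.\<close>

lemma wp_all_tuples:
  "\<lbrakk>j \<le> 2 * c; ready R; \<forall>i<2 * c. j \<le> i \<longrightarrow> tuple R i \<in> {1..n}; summary c W R\<rbrakk> \<Longrightarrow>
    wp M (tuples_time (process_time n c) n j) (all_tuples (process_tuple c) j)
      (\<lambda>R'. summary c (W \<union> tuples n j (tuple R)) R' \<and> ready R' \<and> (\<forall>i\<ge>j. tuple R' i = tuple R i)) R"
proof (induction j arbitrary: R W)
  case 0
  then have "wp M (process_time n c) (process_tuple c) (\<lambda>R'. summary c (insert (tuple R) W) R' \<and>
    ready R' \<and> tuple R' = tuple R) R" by (intro wp_process_tuple) auto
  then show ?case unfolding all_tuples.simps tuples_time.simps
    by (rule wp_mono) (auto simp: tuples_0)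
next
  case (Suc j)
  define I where "I i R' \<longleftrightarrow> R' (12 + j) = i \<and> i \<le> n \<and> ready R' \<and> (\<forall>i\<ge>Suc j. tuple R' i = tuple R i) \<and>
    summary c (W \<union> (\<Union>m\<in>{i<..n}. tuples n j ((tuple R)(j := m)))) R'" for i :: nat and R' :: "nat \<Rightarrow> nat"
  have step: "wp M (tuples_time (process_time n c) n j) (all_tuples (process_tuple c) j)
      (\<lambda>S. I i (S(12 + j := S (12 + j) - S 2))) R'" if I: "I (Suc i) R'" for i R'
  proof -
    define W' where "W' = W \<union> (\<Union>m\<in>{Suc i<..n}. tuples n j ((tuple R)(j := m)))"
    have j: "tuple R' j = Suc i" "Suc i \<le> n" using I by (auto simp: I_def tuple_def)
    \<comment> \<open>Earlier runs change positions below \<open>j\<close>, but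
      \<open>tuples n j\<close> depends only on the positions from \<open>j\<close> on.\<close>
    have eq: "tuples n j (tuple R') = tuples n j ((tuple R)(j := Suc i))"
    proof -
      have "\<forall>i'\<ge>j. tuple R' i' = ((tuple R)(j := Suc i)) i'" using I j by (auto simp: I_def Suc_le_eq)
      then show ?thesis unfolding tuples_def by auto
    qed
    have "{i<..n} = insert (Suc i) {Suc i<..n}" using j(2) by auto
    then have W': "W' \<union> tuples n j (tuple R') = W \<union> (\<Union>m\<in>{i<..n}. tuples n j ((tuple R)(j := m)))"
      by (auto simp: W'_def eq)
    have "\<forall>i'<2 * c. j \<le> i' \<longrightarrow> tuple R' i' \<in> {1..n}"
    proof (intro allI impI)
      fix i' assume "i' < 2 * c" "j \<le> i'"
      then show "tuple R' i' \<in> {1..n}"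
        using I j Suc.prems(3) by (cases "i' = j") (auto simp: I_def)
    qed
    then have "wp M (tuples_time (process_time n c) n j) (all_tuples (process_tuple c) j)
      (\<lambda>S. summary c (W' \<union> tuples n j (tuple R')) S \<and> ready S \<and> (\<forall>i\<ge>j. tuple S i = tuple R' i)) R'"
      using I Suc.prems(1) by (intro Suc.IH) (auto simp: I_def W'_def)
    then show ?thesis
    proof (rule wp_mono)
      fix S assume S: "summary c (W' \<union> tuples n j (tuple R')) S \<and> ready S \<and> (\<forall>i\<ge>j. tuple S i = tuple R' i)"
      then have "S (12 + j) = Suc i" using j by (auto simp: tuple_def)
      moreover have "\<forall>i'\<ge>Suc j. tuple S i' = tuple R i'" using S I by (auto simp: I_def)
      ultimately show "I i (S(12 + j := S (12 + j) - S 2))"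
        using S j(2) unfolding W' by (auto simp: I_def summary_def ready_def tuple_def)
    qed simp
  qed
  have "I n (R(12 + j := R 1 + R 0))"
    using Suc.prems by (auto simp: I_def ready_def tuple_def summary_def)
  then have "wp M (n * (tuples_time (process_time n c) n j + 2) + 1) (countdown (12 + j) (all_tuples (process_tuple c) j))
      (I 0) (R(12 + j := R 1 + R 0))"
    by (intro wp_countdown[of I, OF step]) (auto simp: I_def)
  then show ?case unfolding all_tuples.simps tuples_time.simps
    by (intro wp_Seq wp_Add, elim wp_mono) (auto simp: I_def tuples_Suc)
qed

definition result :: "nat \<Rightarrow> nat \<Rightarrow> nat \<Rightarrow> nat" where
  "result c T F = (if T div (2 * threshold c) = 0 then F else T div (2 * threshold c))"

lemma wp_load_coloring:
  "wp M (total_time n c) (load_coloring c) (\<lambda>R. \<exists>S. summary c (tuples n (2 * c) (\<lambda>_. 0)) S \<and>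
    R 0 = result c (S 9) (S 10)) (\<lambda>_. 0)"
proof -
  define A where "A = 2 * threshold c"
  define W where "W = tuples n (2 * c) (\<lambda>_. 0)"
  have A: "A > 0" by (simp add: A_def threshold_def)
  \<comment> \<open>Besides building \<open>n * n\<close>, the loop keeps the flag and the tuple at
    zero, which is the summary of no tuples.\<close>
  define I where "I i R \<longleftrightarrow> R 6 = i \<and> i \<le> n \<and> R 9 = (n - i) * n \<and> ready R \<and> (\<forall>r\<ge>10. R r = 0)"
    for i :: nat and R :: "nat \<Rightarrow> nat"
  have step: "wp M 1 (Add 9 9 1) (\<lambda>S. I i (S(6 := S 6 - S 2))) R" if "I (Suc i) R" for i R
  proof (rule wp_Add)
    have "n - i = Suc (n - Suc i)" using that by (auto simp: I_def)
    then show "I i ((R(9 := R 9 + R 1))(6 := (R(9 := R 9 + R 1)) 6 - (R(9 := R 9 + R 1)) 2))"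
      using that by (auto simp: I_def ready_def)
  qed
  have init: "wp M (n * (1 + 2) + 1) (countdown 6 (Add 9 9 1)) (I 0) R" if "I n R" for R
    by (rule wp_countdown[of I, OF step _ that]) (auto simp: I_def)
  have tup: "wp M (tuples_time (process_time n c) n (2 * c)) (all_tuples (process_tuple c) (2 * c))
      (\<lambda>R. summary c W R \<and> ready R) R" if "I 0 R" for R
  proof -
    have "tuple R = (\<lambda>_. 0)" using that by (auto simp: I_def tuple_def)
    then have "tuples n (2 * c) (tuple R) = W" by (simp add: W_def)
    moreover have "summary c {} R" "ready R" using that by (auto simp: I_def summary_def)
    then have "wp M (tuples_time (process_time n c) n (2 * c)) (all_tuples (process_tuple c) (2 * c))
      (\<lambda>R'. summary c ({} \<union> tuples n (2 * c) (tuple R)) R' \<and> ready R' \<and> (\<forall>i\<ge>2 * c. tuple R' i = tuple R i)) R"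
      by (intro wp_all_tuples) auto
    ultimately show ?thesis by (elim wp_mono) auto
  qed
  let ?Q = "\<lambda>R. \<exists>S. summary c W S \<and> R 0 = result c (S 9) (S 10)"
  have tail: "wp M (1 + (1 + (1 + (n * n * 3 + 1 + 2))))
    (Seq (Const 7 A) (Seq (Add 6 9 2) (Seq (Sub 6 6 7)
    (Seq (While_Nonzero 6 (Seq (Add 0 0 2) (Sub 6 6 7))) (If_Nonzero 0 skip (Add 0 0 10)))))) ?Q S"
    if S: "summary c W S \<and> ready S" for S
  proof -
    define T where "T = S 9"
    \<comment> \<open>\<open>i\<close> subtractions remain. Register 6 is the current remainder plus
      one minus \<open>A\<close>, truncated, hence zero once the remainder is below
      \<open>A\<close>.\<close>
    define L where "L i R \<longleftrightarrow> i \<le> T div A \<and> R 0 = T div A - i \<and> R 6 = i * A + T mod A + 1 - A \<and>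
      R 7 = A \<and> R 2 = 1 \<and> R 10 = S 10" for i and R :: "nat \<Rightarrow> nat"
    have body: "R 6 \<noteq> 0 \<and> wp M (1 + 1) (Seq (Add 0 0 2) (Sub 6 6 7)) (L i) R" if L: "L (Suc i) R" for i R
    proof
      show "wp M (1 + 1) (Seq (Add 0 0 2) (Sub 6 6 7)) (L i) R"
      proof (intro wp_Seq wp_Add wp_Sub)
        have "T div A - i = Suc (T div A - Suc i)" using L by (auto simp: L_def)
        then show "L i ((R(0 := R 0 + R 2))(6 := (R(0 := R 0 + R 2)) 6 - (R(0 := R 0 + R 2)) 7))"
          using L by (auto simp: L_def)
      qed
    qed (use L in \<open>auto simp: L_def\<close>)
    have exit: "R 6 = 0" if "L 0 R" for R
    proof -
      have "T mod A < A" using A by simp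
      then show ?thesis using that by (simp add: L_def)
    qed
    have while: "wp M (T div A * (1 + 1 + 1) + 1) (While_Nonzero 6 (Seq (Add 0 0 2) (Sub 6 6 7))) (L 0) R"
      if "L (T div A) R" for R
    proof (rule wp_While[of L])
      show "L (T div A) R" by (rule that)
    qed (use body exit in auto)
    have last: "wp M 2 (If_Nonzero 0 skip (Add 0 0 10)) ?Q R" if R: "L 0 R" for R
    proof -
      have "wp M (max 1 1 + 1) (If_Nonzero 0 (Const 4 0) (Add 0 0 10)) ?Q R"
        using S R by (intro wp_If wp_Const wp_Add exI[of _ S])
          (auto simp: L_def T_def A_def result_def)
      then show ?thesis by (simp add: skip_def numeral_2_eq_2)
    qed
    have "T \<le> n * n" using S by (simp add: T_def summary_def)
    then have "T div A \<le> n * n" using div_le_dividend le_trans by blast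
    then have time: "T div A * (1 + 1 + 1) + 1 \<le> n * n * 3 + 1"
      by (intro add_mono mult_le_mono) simp_all
    let ?S = "S(7 := A, 6 := S 9 + S 2)"
    have "L (T div A) (?S(6 := ?S 6 - ?S 7))"
      using S by (auto simp: L_def T_def ready_def)
    from wp_mono[OF while[OF this] last time] show ?thesis
      by (intro wp_Seq wp_Const wp_Add wp_Sub) simp
  qed
  have start: "I n ((\<lambda>_. 0)(1 := n, 2 := 1, 6 := n))" by (auto simp: I_def ready_def)
  have "wp M (n * (1 + 2) + 1 + (tuples_time (process_time n c) n (2 * c) + (1 + (1 + (1 + (n * n * 3 + 1 + 2))))))
    (Seq (countdown 6 (Add 9 9 1)) (Seq (all_tuples (process_tuple c) (2 * c)) (Seq (Const 7 A) (Seq (Add 6 9 2) (Seq (Sub 6 6 7)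
    (Seq (While_Nonzero 6 (Seq (Add 0 0 2) (Sub 6 6 7))) (If_Nonzero 0 skip (Add 0 0 10))))))))
    ?Q ((\<lambda>_. 0)(1 := n, 2 := 1, 6 := n))"
    by (rule wp_Seq, rule wp_mono[OF init[OF start] _ order_refl], rule wp_Seq,
        rule wp_mono[OF tup tail order_refl])
  then have "wp M (1 + (1 + (1 + (n * (1 + 2) + 1 + (tuples_time (process_time n c) n (2 * c) + (1 + (1 + (1 + (n * n * 3 + 1 + 2)))))))))
    (load_coloring c) ?Q (\<lambda>_. 0)"
    unfolding load_coloring_def A_def[symmetric]
    by (rule_tac wp_Seq, rule_tac wp_Load, rule_tac wp_Seq, rule_tac wp_Const, rule_tac wp_Seq, rule_tac wp_Add)
      (simp add: size)
  then show ?thesis unfolding W_def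
    by (rule wp_time) (simp add: total_time_def)
qed

end

section \<open>The algorithm on encoded graphs\<close>

lemma poly_nat_mono: "x \<le> y \<Longrightarrow> poly (b :: nat poly) x \<le> poly b y"
  by (induction b) (auto intro: add_mono mult_le_mono)

definition poly_bounded :: "(nat \<Rightarrow> nat) \<Rightarrow> bool" where
  "poly_bounded f \<longleftrightarrow> (\<exists>b :: nat poly. \<forall>n. f n \<le> poly b n)"

lemma poly_bounded_const: "poly_bounded (\<lambda>_. k)"
  unfolding poly_bounded_def by (intro exI[of _ "[:k:]"]) simp

lemma poly_bounded_ident: "poly_bounded (\<lambda>n. n)"
  unfolding poly_bounded_def by (intro exI[of _ "[:0, 1:]"]) simp

lemma poly_bounded_add: "poly_bounded f \<Longrightarrow> poly_bounded g \<Longrightarrow> poly_bounded (\<lambda>n. f n + g n)"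
  unfolding poly_bounded_def by (metis add_mono poly_add)

lemma poly_bounded_mult: "poly_bounded f \<Longrightarrow> poly_bounded g \<Longrightarrow> poly_bounded (\<lambda>n. f n * g n)"
  unfolding poly_bounded_def by (metis mult_le_mono poly_mult)

lemmas poly_bounded_intros = poly_bounded_const poly_bounded_ident poly_bounded_add poly_bounded_mult

text \<open>For fixed \<open>j\<close> the recursion multiplies by \<open>n\<close> only
  \<open>j\<close> times.\<close>

lemma poly_bounded_tuples_time: "poly_bounded B \<Longrightarrow> poly_bounded (\<lambda>n. tuples_time (B n) n j)"
  by (induction j) (auto simp del: One_nat_def add_2_eq_Suc' intro!: poly_bounded_intros)

lemma poly_bounded_total_time: "poly_bounded (\<lambda>n. total_time n c)"
  unfolding total_time_def process_time_def count_time_def check_time_def test_time_def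
  by (intro poly_bounded_intros poly_bounded_tuples_time)

section \<open>Encoded graphs\<close>

lemma concat_rows_nth:
  "i < m \<Longrightarrow> j < n \<Longrightarrow> concat (map (\<lambda>i. map (f i) [0..<n]) [0..<m]) ! (i * n + j) = f i j"
proof (induction m)
  case (Suc m)
  have len: "length (concat (map (\<lambda>i. map (f i) [0..<n]) [0..<m])) = m * n"
    by (induction m) auto
  show ?case
  proof (cases "i < m")
    case True
    then have "Suc i * n \<le> m * n" by (intro mult_le_mono1) simp
    moreover have "i * n + j < Suc i * n" using Suc.prems(2) by simp
    ultimately have "i * n + j < m * n" by linarith
    then show ?thesis using Suc.IH[OF True Suc.prems(2)] by (simp add: nth_append len)
  next
    case False
    then have "i = m" using Suc.prems(1) by simp
    then show ?thesis using Suc.prems(2) by (simp add: nth_append len)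
  qed
qed simp

lemma length_encode_graph: "length (encode_graph n E) = Suc (n * n)"
proof -
  have "length (concat (map (\<lambda>i. map (f i) [0..<n]) [0..<m])) = m * n" for m and f :: "nat \<Rightarrow> nat \<Rightarrow> nat"
    by (induction m) auto
  then show ?thesis by (simp add: encode_graph_def)
qed

definition edge_entry :: "nat set set \<Rightarrow> nat \<Rightarrow> nat \<Rightarrow> bool" where
  "edge_entry E i j \<longleftrightarrow> {i - 1, j - 1} \<in> E"

lemma graph_memory_encode:
  "graph_memory (snd (initial_state (encode_graph n E))) n (edge_entry E)"
proof
  show "snd (initial_state (encode_graph n E)) 0 = n"
    by (simp add: initial_state_def encode_graph_def)
  fix i j assume ij: "i \<in> {1..n}" "j \<in> {1..n}"
  then obtain i' j' where i': "i = Suc i'" "i' < n" "j = Suc j'" "j' < n"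
    by (cases i; cases j) auto
  \<comment> \<open>The address must stay within the input, beyond which the memory reads 0.\<close>
  have "Suc i' * n \<le> n * n" using i' by (intro mult_le_mono1) simp
  moreover have "i' * n + j' < Suc i' * n" using i' by simp
  ultimately have "(i - 1) * n + j < length (encode_graph n E)"
    unfolding length_encode_graph using i' by simp
  moreover have "encode_graph n E ! ((i - 1) * n + j) = of_bool ({i', j'} \<in> E)"
    using concat_rows_nth[OF i'(2,4), of "\<lambda>i j. if {i, j} \<in> E then 1 else (0::nat)"] i'
    by (simp add: encode_graph_def)
  ultimately show "snd (initial_state (encode_graph n E)) ((i - 1) * n + j) = of_bool (edge_entry E i j)"
    using i' by (simp add: initial_state_def edge_entry_def)
qed

locale encoded_graph =
  fixes n :: nat and E :: "nat set set" and c :: nat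
  assumes c: "c > 0" and graph: "simple_graph {..<n} E"
begin

sublocale graph_memory "snd (initial_state (encode_graph n E))" n "edge_entry E"
  by (rule graph_memory_encode)

definition removed :: "(nat \<Rightarrow> nat) \<Rightarrow> nat set" where
  "removed w = (\<lambda>p. w p - 1) ` {..<c - 1}"

text \<open>Every surviving edge is counted in both directions. Entries are at least 1, so the shift
  \<open>w p - 1\<close> is injective on them.\<close>

lemma removal_arcs_eq:
  assumes "\<And>p. p < 2 * c \<Longrightarrow> w p \<in> {1..n}"
  shows "removal_arcs c w = 2 * card (induced E ({..<n} - removed w))"
proof -
  have r: "Suc i \<in> w ` {..<c - 1} \<longleftrightarrow> i \<in> removed w" for i
  proof -
    have "w p = Suc i \<longleftrightarrow> w p - 1 = i" if "p < c - 1" for p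
    proof -
      have "w p \<in> {1..n}" using that by (intro assms) simp
      then show ?thesis by auto
    qed
    then show ?thesis unfolding removed_def image_iff by (metis lessThan_iff)
  qed
  have S: "{0<..n} = Suc ` {..<n}"
    unfolding image_Suc_lessThan by auto
  have "removal_arcs c w = (\<Sum>i<n. \<Sum>j<n. of_bool ({i, j} \<in> E \<and> i \<notin> removed w \<and> j \<notin> removed w))"
    unfolding removal_arcs_def S by (simp add: sum.reindex r edge_entry_def del: sum_of_bool_eq One_nat_def)
  also have "\<dots> = (\<Sum>i\<in>{..<n} - removed w. \<Sum>j<n. of_bool ({i, j} \<in> E \<and> i \<notin> removed w \<and> j \<notin> removed w))"
    by (intro sum.mono_neutral_right) (auto simp del: sum_of_bool_eq)
  also have "\<dots> = (\<Sum>i\<in>{..<n} - removed w. \<Sum>j\<in>{..<n} - removed w. of_bool ({i, j} \<in> E))"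
    by (intro sum.cong refl sum.mono_neutral_cong_right) auto
  also have "\<dots> = 2 * card (induced E ({..<n} - removed w))"
    using arcs_self[of "{..<n} - removed w" E] graph
    by (simp add: arcs_def simple_graph_def del: sum_of_bool_eq)
  finally show ?thesis .
qed

lemma card_removed: "card (removed w) < c"
  using card_image_le[of "{..<c - 1}" "\<lambda>p. w p - 1"] c by (simp add: removed_def)

text \<open>Inclusion suffices, since deleting more only lowers the edge count. This allows filling
  the free positions with 1, a valid entry because \<open>n > 0\<close>.\<close>

lemma obtain_tuple_removing:
  assumes "S \<subseteq> {..<n}" "card S < c" "n > 0"
  obtains w where "w \<in> tuples n (2 * c) (\<lambda>_. 0)" "S \<subseteq> removed w"
proof -
  have "finite S" using assms(1) by (rule finite_subset) simp
  then obtain f where f: "bij_betw f {0..<card S} S" using ex_bij_betw_nat_finite by blast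
  define w where "w p = (if p < 2 * c then if p < card S then Suc (f p) else 1 else 0)" for p
  have "f p < n" if "p < card S" for p
    using bij_betwE[OF f] that assms(1) by auto
  then have "w \<in> tuples n (2 * c) (\<lambda>_. 0)" using assms(3) by (auto simp: tuples_def w_def Suc_le_eq)
  moreover have "S \<subseteq> removed w"
  proof
    fix s assume "s \<in> S"
    then obtain p where "p < card S" "s = f p" using f unfolding bij_betw_def by fastforce
    then show "s \<in> removed w" using assms(2) unfolding removed_def
      by (intro image_eqI[of _ _ p]) (auto simp: w_def)
  qed
  ultimately show thesis by (rule that)
qed

lemma matched_iff_LCP_1: "(\<exists>w\<in>tuples n (2 * c) (\<lambda>_. 0). matched c w) \<longleftrightarrow> LCP c 1 {..<n} E"
  unfolding LCP_1_iff_matching[OF c graph]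
proof
  assume "\<exists>w\<in>tuples n (2 * c) (\<lambda>_. 0). matched c w"
  then obtain w where w: "\<And>p. p < 2 * c \<Longrightarrow> w p \<in> {1..n}" "matched c w" by (auto simp: tuples_def)
  have "inj_on (\<lambda>p. w p - 1) {..<2 * c}"
  proof (rule inj_onI)
    fix p q assume pq: "p \<in> {..<2 * c}" "q \<in> {..<2 * c}" "w p - 1 = w q - 1"
    then have "w p = w q" using w(1)[of p] w(1)[of q] by auto
    then show "p = q" using w(2) pq(1,2) unfolding matched_def by (meson inj_onD)
  qed
  moreover have "w p - 1 < n" if "p < 2 * c" for p using w(1)[OF that] by auto
  ultimately show "\<exists>w. w ` {..<2 * c} \<subseteq> {..<n} \<and> is_matching c E w"
    using w(2) by (intro exI[of _ "\<lambda>p. w p - 1"]) (auto simp: is_matching_def matched_def edge_entry_def)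
next
  assume "\<exists>w. w ` {..<2 * c} \<subseteq> {..<n} \<and> is_matching c E w"
  then obtain w where w: "w ` {..<2 * c} \<subseteq> {..<n}" "is_matching c E w" by blast
  define u where "u p = (if p < 2 * c then Suc (w p) else 0)" for p
  have "u \<in> tuples n (2 * c) (\<lambda>_. 0)" using w(1) by (auto simp: tuples_def u_def Suc_le_eq)
  moreover have "matched c u" using w(2) by (auto simp: matched_def is_matching_def u_def inj_on_def edge_entry_def)
  ultimately show "\<exists>w\<in>tuples n (2 * c) (\<lambda>_. 0). matched c w" by blast
qed

lemma result_correct:
  assumes R: "summary c (tuples n (2 * c) (\<lambda>_. 0)) R"
  shows "LCP c (result c (R 9) (R 10)) {..<n} E"
    and "real (k_opt c {..<n} E) \<le> 2 ^ (c - 1) * P c * real (result c (R 9) (R 10))"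
proof -
  have range: "w p \<in> {1..n}" if "w \<in> tuples n (2 * c) (\<lambda>_. 0)" "p < 2 * c" for w p
    using that by (auto simp: tuples_def)
  have le: "R 9 \<le> 2 * card (induced E ({..<n} - S))" if S: "S \<subseteq> {..<n}" "card S < c" for S
  proof (cases "n = 0")
    \<comment> \<open>Without vertices there are no tuples, but then the initial value
      \<open>n * n\<close> is 0.\<close>
    case True
    then have "n * n = 0" by simp
    then show ?thesis using R unfolding summary_def by linarith
  next
    case False
    then obtain w where w: "w \<in> tuples n (2 * c) (\<lambda>_. 0)" "S \<subseteq> removed w"
      using obtain_tuple_removing[OF S] by blast
    have "R 9 \<le> removal_arcs c w" using R w(1) by (simp add: summary_def)
    also have "\<dots> = 2 * card (induced E ({..<n} - removed w))"
      by (rule removal_arcs_eq) (rule range[OF w(1)])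
    also have "\<dots> \<le> 2 * card (induced E ({..<n} - S))"
      using w(2) simple_graph_finite_edges[OF graph] by (intro mult_le_mono2 card_induced_mono) auto
    finally show ?thesis .
  qed
  have "\<exists>S. finite S \<and> card S < c \<and> 2 * card (induced E ({..<n} - S)) \<le> R 9"
  proof (cases "R 9 = n * n")
    \<comment> \<open>If register 9 still has its initial value, the empty deletion set serves, as
      there are at most \<open>n * n\<close> arcs.\<close>
    case True
    have "2 * card (induced E {..<n}) = card {(x, y) \<in> {..<n} \<times> {..<n}. {x, y} \<in> E}"
      using graph by (subst arcs_self[symmetric]) (auto simp: simple_graph_def arcs_card)
    also have "\<dots> \<le> card ({..<n} \<times> {..<n})" by (intro card_mono) auto
    finally show ?thesis using True c by (intro exI[of _ "{}"]) simp
  next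
    case False
    then obtain w where w: "w \<in> tuples n (2 * c) (\<lambda>_. 0)" "R 9 = removal_arcs c w"
      using R by (auto simp: summary_def)
    moreover have "removal_arcs c w = 2 * card (induced E ({..<n} - removed w))"
      by (rule removal_arcs_eq) (rule range[OF w(1)])
    ultimately show ?thesis using card_removed by (intro exI[of _ "removed w"]) (auto simp: removed_def)
  qed
  then obtain S where S: "finite S" "card S < c" "2 * card (induced E ({..<n} - S)) \<le> R 9" by blast
  have F: "R 10 = of_bool (LCP c 1 {..<n} E)"
    using R by (simp add: summary_def matched_iff_LCP_1)
  show "LCP c (result c (R 9) (R 10)) {..<n} E"
    by (rule approximation_by_thresholds(1)[OF c graph le S F]) (auto simp: result_def)
  show "real (k_opt c {..<n} E) \<le> 2 ^ (c - 1) * P c * real (result c (R 9) (R 10))"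
    by (rule approximation_by_thresholds(2)[OF c graph le S F]) (auto simp: result_def)
qed

end

theorem theorem3:
  fixes c :: nat
  assumes "c > 0"
  shows "\<exists>p. LC_approximation_algorithm c (2 ^ (c - 1) * P c) p"
proof -
  obtain b :: "nat poly" where b: "\<And>n. total_time n c \<le> poly b n"
    using poly_bounded_total_time[of c] by (auto simp: poly_bounded_def)
  have "\<exists>t k. halts_with (load_coloring c) (encode_graph n E) t k \<and>
      t \<le> poly b (length (encode_graph n E)) \<and> LCP c k {..<n} E \<and>
      real (k_opt c {..<n} E) \<le> 2 ^ (c - 1) * P c * real k"
    if graph: "simple_graph {..<n} E" for n E
  proof -
    interpret encoded_graph n E c using assms graph by (rule encoded_graph.intro)
    let ?M = "snd (initial_state (encode_graph n E))"
    obtain t R S where R: "t \<le> total_time n c" "exec (load_coloring c) (\<lambda>_. 0, ?M) t (R, ?M)"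
      "summary c (tuples n (2 * c) (\<lambda>_. 0)) S" "R 0 = result c (S 9) (S 10)"
      using wp_load_coloring[of c] unfolding wp_def by blast
    have "halts_with (load_coloring c) (encode_graph n E) t (R 0)"
      using R(2) unfolding halts_with_def by (auto simp: initial_state_def)
    \<comment> \<open>The time bound in \<open>n\<close> carries over to the input length
      \<open>n * n + 1\<close> by monotonicity.\<close>
    moreover have "n \<le> length (encode_graph n E)"
      unfolding length_encode_graph by (cases n) auto
    then have "poly b n \<le> poly b (length (encode_graph n E))" by (rule poly_nat_mono)
    then have "t \<le> poly b (length (encode_graph n E))" using R(1) b[of n] by linarith
    ultimately show ?thesis using result_correct[OF R(3)] unfolding R(4)[symmetric] by blast
  qed
  then show ?thesis unfolding LC_approximation_algorithm_def by blast
qed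

end
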